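(* Let $\mathcal{C}$ be a $\operatorname{Hom}$-finite Krull-Schmidt triangulated category and let $\mathcal{T}$ be a cluster-tilting subcategory of $\mathcal{C}$. (a) For every $X\in\mathcal{C}$ having no direct summands in $\mathcal{T}[1]$, $\operatorname{pd}\mathsf{H}X=\infty$ if and only if $\mathcal{I}_X(\mathcal{T}[1])\neq 0$. (b) For every $X\in\mathcal{C}$, $\operatorname{pd}\mathsf{H}X=\infty$ if and only if $\mathcal{I}_{\overline{X}}(\mathcal{T}[1])\neq 0$.
   Context: Conventions: $[1]$ is the shift functor of $\mathcal{C}$. $\mathcal{T}$ is a full subcategory of $\mathcal{C}$ closed under isomorphisms, direct sums and direct summands; $\mathcal{T}[i]$ is the full subcategory of objects isomorphic to $T[i]$ with $T\in\mathcal{T}$. 'Having no direct summands in $\mathcal{T}[1]$' means having no nonzero direct summands in $\mathcal{T}[1]$. A morphism $f:T\to X$ with $T\in\mathcal{T}$ is a right $\mathcal{T}$-approximation of $X$ if every morphism from an object of $\mathcal{T}$ to $X$ factors through $f$; $\mathcal{T}$ is contravariantly finite if every $X\in\mathcal{C}$ admits a right $\mathcal{T}$-approximation. Left approximations and covariantly finite are defined dually; functorially finite means both. $\mathcal{T}$ is cluster-tilting ($2$-cluster-tilting) if: (1) $\mathcal{T}$ is functorially finite; (2) $X\in\mathcal{T}$ iff $\operatorname{Hom}_{\mathcal{C}}(T,X[1])=0$ for all $T\in\mathcal{T}$; (3) $X\in\mathcal{T}$ iff $\operatorname{Hom}_{\mathcal{C}}(X,T[1])=0$ for all $T\in\mathcal{T}$.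 $\operatorname{mod}\mathcal{T}$ is the category of finitely presented contravariant (additive) functors on $\mathcal{T}$; it is abelian with enough projectives, and $\operatorname{pd}$ denotes projective dimension in it. $\mathsf{H}:\mathcal{C}\to\operatorname{mod}\mathcal{T}$ is the functor $\mathsf{H}(X)=\operatorname{Hom}_{\mathcal{C}}(-,X)|_{\mathcal{T}}$. For $M\in\mathcal{C}$, $\mathcal{I}_M(\mathcal{T}[1])$ is the ideal of $\mathcal{T}[1]$ consisting of all morphisms between objects of $\mathcal{T}[1]$ that factor (in $\mathcal{C}$) through $M$; it is $\neq 0$ if it contains a nonzero morphism. For $X\in\mathcal{C}$, $\overline{X}$ is the direct sum of all indecomposable direct summands of $X$ (in a Krull-Schmidt decomposition, with multiplicity) not contained in $\mathcal{T}[1]$; in particular $\overline{X}=0$ if $X\in\mathcal{T}[1]$. *)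

theory Defs
  imports Complex_Main "HOL-Library.Extended_Nat"
begin

section \<open>Linear categories\<close>

text \<open>
  A small category that is linear over a field is presented by a type of objects and a
  single ambient vector space of morphisms, in which every Hom space is a subspace; composition
  and the shift are only specified on composable morphisms of the category.  This is no loss of
  generality: for the ambient space take the direct sum of all Hom spaces.  In particular all
  zero morphisms are the element 0 of the ambient space.  \<open>g \<cdot> f\<close> is ``first f, then g''.
\<close>

record ('o, 'm, 'k) lin_cat =
  hom :: "'o \<Rightarrow> 'o \<Rightarrow> 'm set"
  cmp :: "'m \<Rightarrow> 'm \<Rightarrow> 'm"  (infixl "\<cdot>\<index>" 70)
  idt :: "'o \<Rightarrow> 'm"
  scl :: "'k \<Rightarrow> 'm \<Rightarrow> 'm"

locale linear_category =
  fixes C :: "('o, 'm::ab_group_add, 'k::field, 'z) lin_cat_scheme" (structure)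
  assumes scl_vector_space: "vector_space (scl C)"
    and hom_subspace: "module.subspace (scl C) (hom C X Y)"
    and idt_in_hom: "idt C X \<in> hom C X X"
    and cmp_in_hom: "\<lbrakk>f \<in> hom C X Y; g \<in> hom C Y Z\<rbrakk> \<Longrightarrow> g \<cdot> f \<in> hom C X Z"
    and cmp_assoc: "\<lbrakk>f \<in> hom C W X; g \<in> hom C X Y; h \<in> hom C Y Z\<rbrakk>
                      \<Longrightarrow> (h \<cdot> g) \<cdot> f = h \<cdot> (g \<cdot> f)"
    and idt_left: "f \<in> hom C X Y \<Longrightarrow> idt C Y \<cdot> f = f"
    and idt_right: "f \<in> hom C X Y \<Longrightarrow> f \<cdot> idt C X = f"
    and cmp_add_right: "\<lbrakk>f \<in> hom C X Y; f' \<in> hom C X Y; g \<in> hom C Y Z\<rbrakk>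
                      \<Longrightarrow> g \<cdot> (f + f') = g \<cdot> f + g \<cdot> f'"
    and cmp_add_left: "\<lbrakk>f \<in> hom C X Y; g \<in> hom C Y Z; g' \<in> hom C Y Z\<rbrakk>
                      \<Longrightarrow> (g + g') \<cdot> f = g \<cdot> f + g' \<cdot> f"
    and cmp_scl_right: "\<lbrakk>f \<in> hom C X Y; g \<in> hom C Y Z\<rbrakk>
                      \<Longrightarrow> g \<cdot> scl C r f = scl C r (g \<cdot> f)"
    and cmp_scl_left: "\<lbrakk>f \<in> hom C X Y; g \<in> hom C Y Z\<rbrakk>
                      \<Longrightarrow> scl C r g \<cdot> f = scl C r (g \<cdot> f)"

definition hom_finite :: "('o, 'm::ab_group_add, 'k::field, 'z) lin_cat_scheme \<Rightarrow> bool" where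
  "hom_finite C \<longleftrightarrow> (\<forall>X Y. \<exists>B. finite B \<and> module.span (scl C) B = hom C X Y)"

definition is_iso :: "('o, 'm, 'k, 'z) lin_cat_scheme \<Rightarrow> 'o \<Rightarrow> 'o \<Rightarrow> 'm \<Rightarrow> bool" where
  "is_iso C X Y f \<longleftrightarrow> f \<in> hom C X Y \<and>
     (\<exists>g \<in> hom C Y X. g \<cdot>\<^bsub>C\<^esub> f = idt C X \<and> f \<cdot>\<^bsub>C\<^esub> g = idt C Y)"

definition isomorphic :: "('o, 'm, 'k, 'z) lin_cat_scheme \<Rightarrow> 'o \<Rightarrow> 'o \<Rightarrow> bool" where
  "isomorphic C X Y \<longleftrightarrow> (\<exists>f. is_iso C X Y f)"

definition zero_object :: "('o, 'm::ab_group_add, 'k, 'z) lin_cat_scheme \<Rightarrow> 'o \<Rightarrow> bool" where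
  "zero_object C Z \<longleftrightarrow> (\<forall>X. hom C Z X = {0} \<and> hom C X Z = {0})"

text \<open>
  \<open>direct_sum C Xs S\<close>: the object S is a direct sum (biproduct) of the finite family Xs, i.e.
  there are injections and projections satisfying the biproduct equations.  S is thereby only
  determined up to isomorphism; for the empty family S is a zero object.
\<close>

definition direct_sum :: "('o, 'm::ab_group_add, 'k, 'z) lin_cat_scheme \<Rightarrow> 'o list \<Rightarrow> 'o \<Rightarrow> bool"
  where
  "direct_sum C Xs S \<longleftrightarrow> (\<exists>i p.
     (\<forall>j < length Xs. i j \<in> hom C (Xs ! j) S \<and> p j \<in> hom C S (Xs ! j)) \<and>
     (\<forall>j < length Xs. \<forall>l < length Xs.
        p j \<cdot>\<^bsub>C\<^esub> i l = (if j = l then idt C (Xs ! j) else 0)) \<and>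
     (\<Sum>j < length Xs. i j \<cdot>\<^bsub>C\<^esub> p j) = idt C S)"

definition direct_summand :: "('o, 'm::ab_group_add, 'k, 'z) lin_cat_scheme \<Rightarrow> 'o \<Rightarrow> 'o \<Rightarrow> bool"
  where
  "direct_summand C Y X \<longleftrightarrow> (\<exists>Y'. direct_sum C [Y, Y'] X)"

definition indecomposable :: "('o, 'm::ab_group_add, 'k, 'z) lin_cat_scheme \<Rightarrow> 'o \<Rightarrow> bool" where
  "indecomposable C X \<longleftrightarrow> \<not> zero_object C X \<and>
     (\<forall>A B. direct_sum C [A, B] X \<longrightarrow> zero_object C A \<or> zero_object C B)"

text \<open>The endomorphism ring is local: it is nonzero and its non-units are closed under addition.\<close>

definition local_end :: "('o, 'm::ab_group_add, 'k, 'z) lin_cat_scheme \<Rightarrow> 'o \<Rightarrow> bool" where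
  "local_end C X \<longleftrightarrow> idt C X \<noteq> 0 \<and>
     (\<forall>f \<in> hom C X X. \<forall>g \<in> hom C X X.
        \<not> is_iso C X X f \<and> \<not> is_iso C X X g \<longrightarrow> \<not> is_iso C X X (f + g))"

definition krull_schmidt :: "('o, 'm::ab_group_add, 'k, 'z) lin_cat_scheme \<Rightarrow> bool" where
  "krull_schmidt C \<longleftrightarrow> (\<forall>X. \<exists>Xs. (\<forall>Y \<in> set Xs. local_end C Y) \<and> direct_sum C Xs X)"


section \<open>Triangulated categories\<close>

text \<open>
  \<open>tri C X Y Z f g h\<close> says that X \<open>\<rightarrow>\<close> Y \<open>\<rightarrow>\<close> Z \<open>\<rightarrow>\<close> X[1], with maps f, g, h, is a distinguished
  triangle.  The shift is only required to be an autoequivalence, which includes the case of an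
  automorphism.
\<close>

record ('o, 'm, 'k) tri_cat = "('o, 'm, 'k) lin_cat" +
  sh :: "'o \<Rightarrow> 'o"
  shm :: "'m \<Rightarrow> 'm"
  tri :: "'o \<Rightarrow> 'o \<Rightarrow> 'o \<Rightarrow> 'm \<Rightarrow> 'm \<Rightarrow> 'm \<Rightarrow> bool"

locale triangulated_category = linear_category C
  for C :: "('o, 'm::ab_group_add, 'k::field, 'z) tri_cat_scheme" (structure) +
  assumes zero_object_exists: "\<exists>Z. zero_object C Z"
    and biproduct_exists: "\<exists>S. direct_sum C [X, Y] S"
    and shm_bij: "bij_betw (shm C) (hom C X Y) (hom C (sh C X) (sh C Y))"
    and shm_idt: "shm C (idt C X) = idt C (sh C X)"
    and shm_cmp: "\<lbrakk>f \<in> hom C X Y; g \<in> hom C Y Z\<rbrakk> \<Longrightarrow> shm C (g \<cdot> f) = shm C g \<cdot> shm C f"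
    and shm_add: "\<lbrakk>f \<in> hom C X Y; f' \<in> hom C X Y\<rbrakk> \<Longrightarrow> shm C (f + f') = shm C f + shm C f'"
    and shm_scl: "f \<in> hom C X Y \<Longrightarrow> shm C (scl C r f) = scl C r (shm C f)"
    and sh_ess_surj: "\<exists>X. isomorphic C (sh C X) Y"
    and tri_in_hom: "tri C X Y Z f g h \<Longrightarrow>
          f \<in> hom C X Y \<and> g \<in> hom C Y Z \<and> h \<in> hom C Z (sh C X)"
    and TR1_iso: "\<lbrakk>tri C X Y Z f g h;
          f' \<in> hom C X' Y'; g' \<in> hom C Y' Z'; h' \<in> hom C Z' (sh C X');
          is_iso C X X' a; is_iso C Y Y' b; is_iso C Z Z' c;
          b \<cdot> f = f' \<cdot> a; c \<cdot> g = g' \<cdot> b; shm C a \<cdot> h = h' \<cdot> c\<rbrakk>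
          \<Longrightarrow> tri C X' Y' Z' f' g' h'"
    and TR1_idt: "zero_object C Z \<Longrightarrow> tri C X X Z (idt C X) 0 0"
    and TR1_cone: "f \<in> hom C X Y \<Longrightarrow> \<exists>Z g h. tri C X Y Z f g h"
    and TR2: "\<lbrakk>f \<in> hom C X Y; g \<in> hom C Y Z; h \<in> hom C Z (sh C X)\<rbrakk>
          \<Longrightarrow> tri C X Y Z f g h \<longleftrightarrow> tri C Y Z (sh C X) g h (- shm C f)"
    and TR3: "\<lbrakk>tri C X Y Z f g h; tri C X' Y' Z' f' g' h';
          a \<in> hom C X X'; b \<in> hom C Y Y'; b \<cdot> f = f' \<cdot> a\<rbrakk>
          \<Longrightarrow> \<exists>c \<in> hom C Z Z'. c \<cdot> g = g' \<cdot> b \<and> shm C a \<cdot> h = h' \<cdot> c"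
    and TR4: "\<lbrakk>tri C X Y Z' f f' f''; tri C Y Z X' g g' g''; tri C X Z Y' (g \<cdot> f) h h''\<rbrakk>
          \<Longrightarrow> \<exists>u \<in> hom C Z' Y'. \<exists>v \<in> hom C Y' X'.
                tri C Z' Y' X' u v (shm C f' \<cdot> g'') \<and>
                u \<cdot> f' = h \<cdot> g \<and> h'' \<cdot> u = f'' \<and> v \<cdot> h = g' \<and> g'' \<cdot> v = shm C f \<cdot> h''"


section \<open>Cluster-tilting subcategories\<close>

text \<open>A full subcategory is given by its set of objects.\<close>

definition closed_subcategory ::
    "('o, 'm::ab_group_add, 'k, 'z) lin_cat_scheme \<Rightarrow> 'o set \<Rightarrow> bool" where
  "closed_subcategory C T \<longleftrightarrow>
     (\<forall>X Y. X \<in> T \<and> isomorphic C X Y \<longrightarrow> Y \<in> T) \<and>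
     (\<forall>Xs S. set Xs \<subseteq> T \<and> direct_sum C Xs S \<longrightarrow> S \<in> T) \<and>
     (\<forall>X Y. X \<in> T \<and> direct_summand C Y X \<longrightarrow> Y \<in> T)"

definition right_approximation ::
    "('o, 'm, 'k, 'z) lin_cat_scheme \<Rightarrow> 'o set \<Rightarrow> 'o \<Rightarrow> 'o \<Rightarrow> 'm \<Rightarrow> bool" where
  "right_approximation C T X A f \<longleftrightarrow> A \<in> T \<and> f \<in> hom C A X \<and>
     (\<forall>B \<in> T. \<forall>g \<in> hom C B X. \<exists>u \<in> hom C B A. g = f \<cdot>\<^bsub>C\<^esub> u)"

definition left_approximation ::
    "('o, 'm, 'k, 'z) lin_cat_scheme \<Rightarrow> 'o set \<Rightarrow> 'o \<Rightarrow> 'o \<Rightarrow> 'm \<Rightarrow> bool" where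
  "left_approximation C T X A f \<longleftrightarrow> A \<in> T \<and> f \<in> hom C X A \<and>
     (\<forall>B \<in> T. \<forall>g \<in> hom C X B. \<exists>u \<in> hom C A B. g = u \<cdot>\<^bsub>C\<^esub> f)"

definition functorially_finite :: "('o, 'm, 'k, 'z) lin_cat_scheme \<Rightarrow> 'o set \<Rightarrow> bool" where
  "functorially_finite C T \<longleftrightarrow>
     (\<forall>X. \<exists>A f. right_approximation C T X A f) \<and>
     (\<forall>X. \<exists>A f. left_approximation C T X A f)"

definition cluster_tilting ::
    "('o, 'm::ab_group_add, 'k, 'z) tri_cat_scheme \<Rightarrow> 'o set \<Rightarrow> bool" where
  "cluster_tilting C T \<longleftrightarrow> closed_subcategory C T \<and> functorially_finite C T \<and>
     (\<forall>X. X \<in> T \<longleftrightarrow> (\<forall>A \<in> T. hom C A (sh C X) = {0})) \<and>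
     (\<forall>X. X \<in> T \<longleftrightarrow> (\<forall>A \<in> T. hom C X (sh C A) = {0}))"

definition shift_subcategory :: "('o, 'm, 'k, 'z) tri_cat_scheme \<Rightarrow> 'o set \<Rightarrow> 'o set" where
  "shift_subcategory C T = {Y. \<exists>A \<in> T. isomorphic C Y (sh C A)}"

definition no_summands_in ::
    "('o, 'm::ab_group_add, 'k, 'z) lin_cat_scheme \<Rightarrow> 'o set \<Rightarrow> 'o \<Rightarrow> bool" where
  "no_summands_in C U X \<longleftrightarrow> (\<forall>Y \<in> U. direct_summand C Y X \<longrightarrow> zero_object C Y)"

text \<open>
  \<open>factor_ideal C U M A B\<close> is the component at (A, B) of the ideal of the subcategory U
  consisting of the morphisms between objects of U that factor through M.
\<close>

definition factor_ideal ::
    "('o, 'm, 'k, 'z) lin_cat_scheme \<Rightarrow> 'o set \<Rightarrow> 'o \<Rightarrow> 'o \<Rightarrow> 'o \<Rightarrow> 'm set" where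
  "factor_ideal C U M A B =
     {f \<in> hom C A B. A \<in> U \<and> B \<in> U \<and> (\<exists>g \<in> hom C A M. \<exists>h \<in> hom C M B. f = h \<cdot>\<^bsub>C\<^esub> g)}"

definition factor_ideal_nonzero ::
    "('o, 'm::ab_group_add, 'k, 'z) lin_cat_scheme \<Rightarrow> 'o set \<Rightarrow> 'o \<Rightarrow> bool" where
  "factor_ideal_nonzero C U M \<longleftrightarrow> (\<exists>A B. \<exists>f \<in> factor_ideal C U M A B. f \<noteq> 0)"

text \<open>
  \<open>reduced_part C U X Y\<close>: Y is obtained from a decomposition of X into indecomposables by
  summing up those summands, with multiplicity, that are not in U.  (By the Krull-Schmidt
  property such a Y exists and is unique up to isomorphism.)
\<close>

definition reduced_part ::
    "('o, 'm::ab_group_add, 'k, 'z) lin_cat_scheme \<Rightarrow> 'o set \<Rightarrow> 'o \<Rightarrow> 'o \<Rightarrow> bool" where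
  "reduced_part C U X Y \<longleftrightarrow> (\<exists>Xs. (\<forall>A \<in> set Xs. indecomposable C A) \<and>
     direct_sum C Xs X \<and> direct_sum C (filter (\<lambda>A. A \<notin> U) Xs) Y)"


section \<open>Finitely presented functors and projective dimension\<close>

text \<open>
  Contravariant additive functors from the subcategory T to abelian groups.  The values are
  additive subgroups of the ambient space of morphisms.  For finitely presented functors this is
  no restriction up to isomorphism: the value at A of the cokernel of a map
  Hom(-,A1) \<open>\<rightarrow>\<close> Hom(-,A0) is the quotient of Hom(A,A0) by a linear subspace, and hence isomorphic
  to a complement of that subspace in Hom(A,A0).

  For f in Hom(A,B), \<open>fmor F A B f\<close> is the induced map from F(B) to F(A).
\<close>

record ('o, 'm) contra_functor =
  fob :: "'o \<Rightarrow> 'm set"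
  fmor :: "'o \<Rightarrow> 'o \<Rightarrow> 'm \<Rightarrow> 'm \<Rightarrow> 'm"

definition additive_functor ::
    "('o, 'm::ab_group_add, 'k, 'z) lin_cat_scheme \<Rightarrow> 'o set \<Rightarrow> ('o, 'm) contra_functor \<Rightarrow> bool"
  where
  "additive_functor C T F \<longleftrightarrow>
     (\<forall>A \<in> T. 0 \<in> fob F A \<and> (\<forall>x \<in> fob F A. \<forall>y \<in> fob F A. x - y \<in> fob F A)) \<and>
     (\<forall>A \<in> T. \<forall>B \<in> T. \<forall>f \<in> hom C A B. \<forall>x \<in> fob F B.
        fmor F A B f x \<in> fob F A \<and>
        (\<forall>y \<in> fob F B. fmor F A B f (x + y) = fmor F A B f x + fmor F A B f y) \<and>
        (\<forall>f' \<in> hom C A B. fmor F A B (f + f') x = fmor F A B f x + fmor F A B f' x)) \<and>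
     (\<forall>A \<in> T. \<forall>x \<in> fob F A. fmor F A A (idt C A) x = x) \<and>
     (\<forall>A \<in> T. \<forall>B \<in> T. \<forall>D \<in> T. \<forall>f \<in> hom C A B. \<forall>g \<in> hom C B D. \<forall>x \<in> fob F D.
        fmor F A D (g \<cdot>\<^bsub>C\<^esub> f) x = fmor F A B f (fmor F B D g x))"

text \<open>The components of a natural transformation are relevant only on the values at objects of T.\<close>

definition nat_transf ::
    "('o, 'm::ab_group_add, 'k, 'z) lin_cat_scheme \<Rightarrow> 'o set \<Rightarrow> ('o, 'm) contra_functor \<Rightarrow>
     ('o, 'm) contra_functor \<Rightarrow> ('o \<Rightarrow> 'm \<Rightarrow> 'm) \<Rightarrow> bool" where
  "nat_transf C T F G \<eta> \<longleftrightarrow>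
     (\<forall>A \<in> T. \<forall>x \<in> fob F A. \<eta> A x \<in> fob G A \<and> (\<forall>y \<in> fob F A. \<eta> A (x + y) = \<eta> A x + \<eta> A y)) \<and>
     (\<forall>A \<in> T. \<forall>B \<in> T. \<forall>f \<in> hom C A B. \<forall>x \<in> fob F B.
        \<eta> A (fmor F A B f x) = fmor G A B f (\<eta> B x))"

text \<open>Exactness of sequences of functors is pointwise exactness at the objects of T.\<close>

definition pointwise_surj ::
    "'o set \<Rightarrow> ('o, 'm) contra_functor \<Rightarrow> ('o, 'm) contra_functor \<Rightarrow> ('o \<Rightarrow> 'm \<Rightarrow> 'm) \<Rightarrow> bool"
  where
  "pointwise_surj T F G \<eta> \<longleftrightarrow> (\<forall>A \<in> T. \<eta> A ` fob F A = fob G A)"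

definition pointwise_inj ::
    "'o set \<Rightarrow> ('o, 'm) contra_functor \<Rightarrow> ('o \<Rightarrow> 'm \<Rightarrow> 'm) \<Rightarrow> bool" where
  "pointwise_inj T F \<eta> \<longleftrightarrow> (\<forall>A \<in> T. inj_on (\<eta> A) (fob F A))"

definition pointwise_exact ::
    "'o set \<Rightarrow> ('o, 'm::zero) contra_functor \<Rightarrow> ('o, 'm) contra_functor \<Rightarrow>
     ('o \<Rightarrow> 'm \<Rightarrow> 'm) \<Rightarrow> ('o \<Rightarrow> 'm \<Rightarrow> 'm) \<Rightarrow> bool" where
  "pointwise_exact T F G \<alpha> \<beta> \<longleftrightarrow> (\<forall>A \<in> T. \<alpha> A ` fob F A = {y \<in> fob G A. \<beta> A y = 0})"

definition H_functor :: "('o, 'm, 'k, 'z) lin_cat_scheme \<Rightarrow> 'o \<Rightarrow> ('o, 'm) contra_functor" where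
  "H_functor C X = \<lparr>fob = (\<lambda>A. hom C A X), fmor = (\<lambda>A B f g. g \<cdot>\<^bsub>C\<^esub> f)\<rparr>"

text \<open>
  Objects of mod T: there is an exact sequence Hom(-,A1) \<open>\<rightarrow>\<close> Hom(-,A0) \<open>\<rightarrow>\<close> F \<open>\<rightarrow>\<close> 0 with A0, A1
  in T.
\<close>

definition finitely_presented ::
    "('o, 'm::ab_group_add, 'k, 'z) lin_cat_scheme \<Rightarrow> 'o set \<Rightarrow> ('o, 'm) contra_functor \<Rightarrow> bool"
  where
  "finitely_presented C T F \<longleftrightarrow> additive_functor C T F \<and>
     (\<exists>A1 \<in> T. \<exists>A0 \<in> T. \<exists>\<alpha> \<pi>.
        nat_transf C T (H_functor C A1) (H_functor C A0) \<alpha> \<and>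
        nat_transf C T (H_functor C A0) F \<pi> \<and>
        pointwise_exact T (H_functor C A1) (H_functor C A0) \<alpha> \<pi> \<and>
        pointwise_surj T (H_functor C A0) F \<pi>)"

text \<open>
  Projective objects of mod T.  Cokernels in mod T are computed pointwise, so the epimorphisms of
  mod T are the pointwise surjective natural transformations.
\<close>

definition projective ::
    "('o, 'm::ab_group_add, 'k, 'z) lin_cat_scheme \<Rightarrow> 'o set \<Rightarrow> ('o, 'm) contra_functor \<Rightarrow> bool"
  where
  "projective C T P \<longleftrightarrow> finitely_presented C T P \<and>
     (\<forall>M N \<epsilon> \<phi>. finitely_presented C T M \<and> finitely_presented C T N \<and>
        nat_transf C T M N \<epsilon> \<and> pointwise_surj T M N \<epsilon> \<and> nat_transf C T P N \<phi> \<longrightarrow>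
        (\<exists>\<psi>. nat_transf C T P M \<psi> \<and> (\<forall>A \<in> T. \<forall>x \<in> fob P A. \<epsilon> A (\<psi> A x) = \<phi> A x)))"

text \<open>
  \<open>projective_resolution C T F n P d\<close>: the sequence
  0 \<open>\<rightarrow>\<close> P n \<open>\<rightarrow>\<close> ... \<open>\<rightarrow>\<close> P 0 \<open>\<rightarrow>\<close> F \<open>\<rightarrow>\<close> 0 is exact in mod T with all P i projective; d 0 is the
  augmentation P 0 \<open>\<rightarrow>\<close> F, and d (i+1) is the differential P (i+1) \<open>\<rightarrow>\<close> P i.
\<close>

definition projective_resolution ::
    "('o, 'm::ab_group_add, 'k, 'z) lin_cat_scheme \<Rightarrow> 'o set \<Rightarrow> ('o, 'm) contra_functor \<Rightarrow> nat \<Rightarrow>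
     (nat \<Rightarrow> ('o, 'm) contra_functor) \<Rightarrow> (nat \<Rightarrow> 'o \<Rightarrow> 'm \<Rightarrow> 'm) \<Rightarrow> bool" where
  "projective_resolution C T F n P d \<longleftrightarrow>
     (\<forall>i \<le> n. projective C T (P i)) \<and>
     nat_transf C T (P 0) F (d 0) \<and>
     (\<forall>i < n. nat_transf C T (P (Suc i)) (P i) (d (Suc i))) \<and>
     pointwise_surj T (P 0) F (d 0) \<and>
     (\<forall>i < n. pointwise_exact T (P (Suc i)) (P i) (d (Suc i)) (d i)) \<and>
     pointwise_inj T (P n) (d n)"

text \<open>Since the infimum of the empty set is \<open>\<infinity>\<close>, pd is \<open>\<infinity>\<close> if there is no finite resolution.\<close>

definition pd ::
    "('o, 'm::ab_group_add, 'k, 'z) lin_cat_scheme \<Rightarrow> 'o set \<Rightarrow> ('o, 'm) contra_functor \<Rightarrow> enat"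
  where
  "pd C T F = Inf {enat n | n. \<exists>P d. projective_resolution C T F n P d}"

end

theory Submission
  imports Defs
begin

text \<open>
  Let \<open>A \<rightarrow> B \<rightarrow> X \<rightarrow> A[1]\<close> be the triangle of a right \<open>T\<close>-approximation \<open>B \<rightarrow> X\<close>; then \<open>A\<close> lies in \<open>T\<close>, and
  \<open>H A \<rightarrow> H B \<rightarrow> H X \<rightarrow> 0\<close> is exact. The kernel of \<open>H A \<rightarrow> H B\<close> consists of the morphisms that become,
  after a shift, compositions \<open>S[1] \<rightarrow> X \<rightarrow> A[1]\<close>, and every morphism \<open>X \<rightarrow> R[1]\<close> with \<open>R\<close> in \<open>T\<close> factors
  through \<open>X \<rightarrow> A[1]\<close>. So the factor ideal of \<open>X\<close> is zero iff \<open>H A \<rightarrow> H B\<close> is mono, and then the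
  projective dimension is at most 1.

  Conversely, a finite resolution of \<open>H X\<close> can be shortened until it shows that the image of
  \<open>H A \<rightarrow> H B\<close> is projective. Then the kernel of \<open>H A \<rightarrow> H B\<close> is cut out by an idempotent of \<open>A\<close>. If this
  idempotent is nonzero, then it is invertible on some indecomposable summand \<open>Y\<close> of \<open>A\<close>, and \<open>Y[1]\<close>
  is a direct summand of \<open>X\<close>.

  Statement (b) reduces to (a), because \<open>H\<close> vanishes on \<open>T[1]\<close>.
\<close>

section \<open>Linear categories\<close>

context linear_category
begin

section \<open>Hom spaces as subspaces and bilinearity of composition\<close>

lemma hom_zero [simp]: "0 \<in> hom C X Y"
  and hom_add [simp]: "\<lbrakk>f \<in> hom C X Y; g \<in> hom C X Y\<rbrakk> \<Longrightarrow> f + g \<in> hom C X Y"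
  and hom_diff [simp]: "\<lbrakk>f \<in> hom C X Y; g \<in> hom C X Y\<rbrakk> \<Longrightarrow> f - g \<in> hom C X Y"
  and hom_uminus [simp]: "f \<in> hom C X Y \<Longrightarrow> - f \<in> hom C X Y"
  and hom_sum: "(\<And>i. i \<in> I \<Longrightarrow> F i \<in> hom C X Y) \<Longrightarrow> sum F I \<in> hom C X Y"
proof -
  interpret vector_space "scl C" by (rule scl_vector_space)
  note S = hom_subspace[of X Y]
  show "0 \<in> hom C X Y" using S by (rule subspace_0)
  show "\<lbrakk>f \<in> hom C X Y; g \<in> hom C X Y\<rbrakk> \<Longrightarrow> f + g \<in> hom C X Y" using S by (rule subspace_add)
  show "\<lbrakk>f \<in> hom C X Y; g \<in> hom C X Y\<rbrakk> \<Longrightarrow> f - g \<in> hom C X Y" using S by (rule subspace_diff)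
  show "f \<in> hom C X Y \<Longrightarrow> - f \<in> hom C X Y" using S by (rule subspace_neg)
  show "(\<And>i. i \<in> I \<Longrightarrow> F i \<in> hom C X Y) \<Longrightarrow> sum F I \<in> hom C X Y"
    using S by (rule subspace_sum)
qed

declare idt_in_hom [simp] idt_left [simp] idt_right [simp]

lemma cmp_zero_right: "g \<in> hom C Y Z \<Longrightarrow> g \<cdot> 0 = 0"
  using cmp_add_right[of 0 Y Y 0 g Z] by simp

lemma cmp_zero_left: "f \<in> hom C X Y \<Longrightarrow> 0 \<cdot> f = 0"
  using cmp_add_left[of f X Y 0 Y 0] by simp

lemma cmp_diff_right:
  assumes "f \<in> hom C X Y" "f' \<in> hom C X Y" "g \<in> hom C Y Z"
  shows "g \<cdot> (f - f') = g \<cdot> f - g \<cdot> f'"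
  using cmp_add_right[of "f - f'" X Y f' g Z] assms by (simp add: algebra_simps)

lemma cmp_diff_left:
  assumes "f \<in> hom C X Y" "g \<in> hom C Y Z" "g' \<in> hom C Y Z"
  shows "(g - g') \<cdot> f = g \<cdot> f - g' \<cdot> f"
  using cmp_add_left[of f X Y "g - g'" Z g'] assms by (simp add: algebra_simps)

lemma cmp_uminus_right: "\<lbrakk>f \<in> hom C X Y; g \<in> hom C Y Z\<rbrakk> \<Longrightarrow> g \<cdot> (- f) = - (g \<cdot> f)"
  using cmp_diff_right[of 0 X Y f g Z] by (simp add: cmp_zero_right)

lemma cmp_uminus_left: "\<lbrakk>f \<in> hom C X Y; g \<in> hom C Y Z\<rbrakk> \<Longrightarrow> (- g) \<cdot> f = - (g \<cdot> f)"
  using cmp_diff_left[of f X Y 0 Z g] by (simp add: cmp_zero_left)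

lemma cmp_sum_right:
  assumes "\<And>i. i \<in> I \<Longrightarrow> F i \<in> hom C X Y" "g \<in> hom C Y Z"
  shows "g \<cdot> sum F I = (\<Sum>i\<in>I. g \<cdot> F i)"
  using assms
proof (induction I rule: infinite_finite_induct)
  case (insert x A)
  have "sum F A \<in> hom C X Y" using insert by (intro hom_sum) auto
  then show ?case using insert by (simp add: cmp_add_right[of _ X Y])
qed (auto simp: cmp_zero_right)

lemma cmp_sum_left:
  assumes "\<And>i. i \<in> I \<Longrightarrow> G i \<in> hom C Y Z" "f \<in> hom C X Y"
  shows "sum G I \<cdot> f = (\<Sum>i\<in>I. G i \<cdot> f)"
  using assms
proof (induction I rule: infinite_finite_induct)
  case (insert x A)
  have "sum G A \<in> hom C Y Z" using insert by (intro hom_sum) auto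
  then show ?case using insert by (simp add: cmp_add_left[of f X Y "G x" Z "sum G A"])
qed (auto simp: cmp_zero_left)

section \<open>Zero objects, isomorphisms and local endomorphism rings\<close>

lemma zero_object_iff: "zero_object C Z \<longleftrightarrow> idt C Z = 0"
proof
  assume "zero_object C Z"
  then show "idt C Z = 0" using idt_in_hom[of Z] by (auto simp: zero_object_def)
next
  assume Z: "idt C Z = 0"
  have "f = 0" if "f \<in> hom C Z X" for f X
    using idt_right[OF that] cmp_zero_right[OF that] Z by simp
  moreover have "f = 0" if "f \<in> hom C X Z" for f X
    using idt_left[OF that] cmp_zero_left[OF that] Z by simp
  ultimately show "zero_object C Z" by (auto simp: zero_object_def)
qed

lemma is_iso_idt: "is_iso C X X (idt C X)"
  unfolding is_iso_def by (metis idt_in_hom idt_left)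

text \<open>If \<open>g\<close> inverts the conjugate of \<open>f\<close>, then
  \<open>a \<cdot> g \<cdot> b\<close> inverts \<open>f\<close>.\<close>

lemma is_iso_sandwich:
  assumes a: "a \<in> hom C X Y" and b: "b \<in> hom C Y X"
    and ba: "b \<cdot> a = idt C X" and ab: "a \<cdot> b = idt C Y"
    and f: "f \<in> hom C Y Y" and iso: "is_iso C X X (b \<cdot> (f \<cdot> a))"
  shows "is_iso C Y Y f"
proof -
  have fa: "f \<cdot> a \<in> hom C X Y" using a f by (rule cmp_in_hom)
  obtain g where g: "g \<in> hom C X X" and l: "g \<cdot> (b \<cdot> (f \<cdot> a)) = idt C X"
    and r: "b \<cdot> (f \<cdot> a) \<cdot> g = idt C X"
    using iso by (auto simp: is_iso_def)
  have ag: "a \<cdot> g \<in> hom C X Y" and gb: "g \<cdot> b \<in> hom C Y X"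
    using a b g by (auto intro: cmp_in_hom)
  have agb: "a \<cdot> g \<cdot> b \<in> hom C Y Y" using b ag by (rule cmp_in_hom)
  have fab: "f = f \<cdot> a \<cdot> b"
    using cmp_assoc[OF b a f] ab f by simp
  have fba: "f = a \<cdot> (b \<cdot> f)"
    using cmp_assoc[OF f b a] ab f by simp
  have "(a \<cdot> g \<cdot> b) \<cdot> f = a \<cdot> (g \<cdot> b) \<cdot> f" using cmp_assoc[OF b g a] by simp
  also have "\<dots> = a \<cdot> (g \<cdot> (b \<cdot> f))" using cmp_assoc[OF f gb a] cmp_assoc[OF f b g] by simp
  also have "b \<cdot> f = b \<cdot> (f \<cdot> a) \<cdot> b" using fab cmp_assoc[OF b fa b] by metis
  also have "g \<cdot> (b \<cdot> (f \<cdot> a) \<cdot> b) = b"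
    using cmp_assoc[OF b cmp_in_hom[OF fa b] g] l b by simp
  finally have 1: "(a \<cdot> g \<cdot> b) \<cdot> f = idt C Y" using ab by simp
  have "f \<cdot> (a \<cdot> g \<cdot> b) = f \<cdot> (a \<cdot> g) \<cdot> b" using cmp_assoc[OF b ag f] by simp
  also have "f \<cdot> (a \<cdot> g) = f \<cdot> a \<cdot> g" using cmp_assoc[OF g a f] by simp
  also have "f \<cdot> a = a \<cdot> (b \<cdot> (f \<cdot> a))" using cmp_assoc[OF fa b a] ab fa by simp
  also have "\<dots> \<cdot> g = a" using cmp_assoc[OF g cmp_in_hom[OF fa b] a] r a by simp
  finally have 2: "f \<cdot> (a \<cdot> g \<cdot> b) = idt C Y" using ab by simp
  from 1 2 f agb show ?thesis unfolding is_iso_def by blast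
qed

text \<open>Conjugation by \<open>a\<close> and \<open>b\<close> is additive and matches the
  non-units of the two endomorphism rings, so closure of the non-units under addition carries
  over.\<close>

lemma local_end_transfer:
  assumes loc: "local_end C X" and ab: "a \<in> hom C X Y" "b \<in> hom C Y X"
    "b \<cdot> a = idt C X" "a \<cdot> b = idt C Y"
  shows "local_end C Y"
  unfolding local_end_def
proof (intro conjI ballI impI)
  show "idt C Y \<noteq> 0"
  proof
    assume "idt C Y = 0"
    then have "b \<cdot> (idt C Y \<cdot> a) = 0"
      using ab(1,2) by (simp add: cmp_zero_left[of a X Y] cmp_zero_right[of b Y X] del: idt_left)
    then show False using ab loc by (simp add: local_end_def)
  qed
  fix f g assume f: "f \<in> hom C Y Y" and g: "g \<in> hom C Y Y"
    and n: "\<not> is_iso C Y Y f \<and> \<not> is_iso C Y Y g"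
  have S: "b \<cdot> (k \<cdot> a) \<in> hom C X X" if "k \<in> hom C Y Y" for k
    using that ab by (auto intro: cmp_in_hom)
  have n': "\<not> is_iso C X X (b \<cdot> (f \<cdot> a))" "\<not> is_iso C X X (b \<cdot> (g \<cdot> a))"
    using n is_iso_sandwich[OF ab] f g by blast+
  have sum: "b \<cdot> (f \<cdot> a) + b \<cdot> (g \<cdot> a) = b \<cdot> ((f + g) \<cdot> a)"
    using ab(1,2) f g
    by (simp add: cmp_add_left[of a X Y] cmp_add_right[of _ X Y] cmp_in_hom[of a X Y])
  have "\<not> is_iso C X X (b \<cdot> (f \<cdot> a) + b \<cdot> (g \<cdot> a))"
    using n' loc S[OF f] S[OF g] by (auto simp: local_end_def)
  then have nis: "\<not> is_iso C X X (b \<cdot> ((f + g) \<cdot> a))" by (simp add: sum)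
  have ba: "(f + g) \<in> hom C Y Y" using f g by simp
  show "\<not> is_iso C Y Y (f + g)"
  proof
    assume iso: "is_iso C Y Y (f + g)"
    \<comment> \<open>Here \<open>is_iso_sandwich\<close> is applied with \<open>a\<close> and
      \<open>b\<close> exchanged, since conjugating back recovers \<open>f + g\<close>.\<close>
    have "is_iso C X X (b \<cdot> ((f + g) \<cdot> a))"
    proof (rule is_iso_sandwich[OF ab(2,1,4,3) S[OF ba]])
      have "a \<cdot> (b \<cdot> ((f + g) \<cdot> a) \<cdot> b) = f + g"
      proof -
        have h: "(f + g) \<cdot> a \<in> hom C X Y" using ab(1) ba by (rule cmp_in_hom)
        have "b \<cdot> ((f + g) \<cdot> a) \<cdot> b = b \<cdot> ((f + g) \<cdot> a \<cdot> b)" using cmp_assoc[OF ab(2) h ab(2)] .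
        also have "(f + g) \<cdot> a \<cdot> b = f + g" using cmp_assoc[OF ab(2) ab(1) ba] ab ba by simp
        finally show ?thesis using cmp_assoc[OF ba ab(2) ab(1)] ab ba by simp
      qed
      then show "is_iso C Y Y (a \<cdot> (b \<cdot> ((f + g) \<cdot> a) \<cdot> b))" using iso by simp
    qed
    then show False using nis by simp
  qed
qed

text \<open>The two endomorphisms add up to the identity, so they cannot both be non-units.\<close>

lemma local_end_complement:
  assumes "local_end C Y" "f \<in> hom C Y Y" "\<not> is_iso C Y Y f"
  shows "is_iso C Y Y (idt C Y - f)"
proof (rule ccontr)
  assume "\<not> is_iso C Y Y (idt C Y - f)"
  then have "\<not> is_iso C Y Y (f + (idt C Y - f))"
    using assms unfolding local_end_def by (meson hom_diff idt_in_hom)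
  then show False using is_iso_idt by simp
qed

text \<open>The categorical form of the fact that the Jacobson radical contains no nonzero idempotent.
  The morphisms g below play the role of radical endomorphisms; 1 - g is inverted by
  clearing one summand at a time, using that 1 - xy has a left inverse if 1 - yx has one.\<close>

lemma idempotent_local_summand:
  fixes n :: nat
  assumes loc: "\<And>j. j < n \<Longrightarrow> local_end C (Y j)"
    and i: "\<And>j. j < n \<Longrightarrow> i j \<in> hom C (Y j) Z"
    and p: "\<And>j. j < n \<Longrightarrow> p j \<in> hom C Z (Y j)"
    and ip: "(\<Sum>j<n. i j \<cdot> p j) = idt C Z"
    and e: "e \<in> hom C Z Z" "e \<cdot> e = e" "e \<noteq> 0"
  shows "\<exists>j<n. \<exists>v \<in> hom C Z (Y j). is_iso C (Y j) (Y j) (v \<cdot> (e \<cdot> i j))"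
proof (rule ccontr)
  assume neg: "\<not> ?thesis"
  let ?rad = "\<lambda>g. g \<in> hom C Z Z \<and>
    (\<forall>j<n. \<forall>v \<in> hom C Z (Y j). \<not> is_iso C (Y j) (Y j) (v \<cdot> (g \<cdot> i j)))"
  let ?s = "\<lambda>k. \<Sum>j<k. i j \<cdot> p j"
  have s: "?s k \<in> hom C Z Z" if "k \<le> n" for k
    using that by (intro hom_sum cmp_in_hom[OF p i]) auto
  \<comment> \<open>The partial sums \<open>?s k\<close> let the induction remove one summand at a
    time; at \<open>k = n\<close> the sum is the identity. \<open>g\<close> is generalized because
    each step replaces it.\<close>
  have "\<exists>L \<in> hom C Z Z. L \<cdot> (idt C Z - g \<cdot> ?s k) = idt C Z" if "k \<le> n" "?rad g" for k g
    using that
  proof (induction k arbitrary: g)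
    case 0
    then have "idt C Z \<cdot> (idt C Z - g \<cdot> 0) = idt C Z" using cmp_zero_right[of g Z Z] idt_left[OF idt_in_hom] by simp
    then show ?case by (auto intro!: bexI[of _ "idt C Z"])
  next
    case (Suc k)
    then have k: "k < n" and g: "g \<in> hom C Z Z" by auto
    note ik = i[OF k] and pk = p[OF k] and sk = s[OF less_imp_le[OF k]]
    let ?Y = "Y k"
    define x where "x = g \<cdot> i k"
    have x: "x \<in> hom C ?Y Z" unfolding x_def using ik g by (rule cmp_in_hom)
    have px: "p k \<cdot> x \<in> hom C ?Y ?Y" using x pk by (rule cmp_in_hom)
    have "\<not> is_iso C ?Y ?Y (p k \<cdot> x)" using Suc.prems k pk by (auto simp: x_def)
    then obtain w where w: "w \<in> hom C ?Y ?Y" and wl: "w \<cdot> (idt C ?Y - p k \<cdot> x) = idt C ?Y"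
      using local_end_complement[OF loc[OF k] px] by (auto simp: is_iso_def)
    have wpx: "w \<cdot> (p k \<cdot> x) = w - idt C ?Y"
      using wl cmp_diff_right[OF idt_in_hom px w] w by (simp add: algebra_simps)
    have wp: "w \<cdot> p k \<in> hom C Z ?Y" using pk w by (rule cmp_in_hom)
    have xp: "x \<cdot> p k \<in> hom C Z Z" using pk x by (rule cmp_in_hom)
    have xwp: "x \<cdot> (w \<cdot> p k) \<in> hom C Z Z" using wp x by (rule cmp_in_hom)
    \<comment> \<open>With \<open>y = p k\<close> and \<open>w\<close> a left inverse of 1 - yx, the
      element 1 + xwy is a left inverse of 1 - xy.\<close>
    define L where "L = idt C Z + x \<cdot> (w \<cdot> p k)"
    have L: "L \<in> hom C Z Z" using xwp by (simp add: L_def)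
    have "x \<cdot> (w \<cdot> p k) \<cdot> (x \<cdot> p k) = x \<cdot> (w \<cdot> p k \<cdot> (x \<cdot> p k))"
      using cmp_assoc[OF xp wp x] .
    also have "w \<cdot> p k \<cdot> (x \<cdot> p k) = w \<cdot> (p k \<cdot> x) \<cdot> p k"
      using cmp_assoc[OF xp pk w] cmp_assoc[OF pk x pk] cmp_assoc[OF pk px w] by simp
    also have "\<dots> = w \<cdot> p k - p k"
      using cmp_diff_left[OF pk w idt_in_hom] wpx pk by simp
    also have "x \<cdot> \<dots> = x \<cdot> (w \<cdot> p k) - x \<cdot> p k" using cmp_diff_right[OF wp pk x] .
    finally have Lx: "L \<cdot> (idt C Z - x \<cdot> p k) = idt C Z"
      using cmp_add_left[OF hom_diff[OF idt_in_hom xp] idt_in_hom xwp]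
        cmp_diff_right[OF idt_in_hom xp xwp] idt_left[OF hom_diff[OF idt_in_hom xp]]
        idt_right[OF xwp] by (simp add: L_def)
    \<comment> \<open>Multiplying by \<open>L\<close> removes the summand of index \<open>k\<close>
      at the cost of replacing \<open>g\<close> by \<open>L \<cdot> g\<close>, which satisfies
      \<open>?rad\<close> again because \<open>v \<cdot> L\<close> is another test morphism.\<close>
    define g' where "g' = L \<cdot> g"
    have g': "g' \<in> hom C Z Z" unfolding g'_def using g L by (rule cmp_in_hom)
    have gs: "g \<cdot> ?s k \<in> hom C Z Z" using sk g by (rule cmp_in_hom)
    have "g \<cdot> ?s (Suc k) = g \<cdot> ?s k + x \<cdot> p k"
      using cmp_add_right[OF sk cmp_in_hom[OF pk ik] g] cmp_assoc[OF pk ik g] by (simp add: x_def)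
    then have "L \<cdot> (idt C Z - g \<cdot> ?s (Suc k)) = L \<cdot> ((idt C Z - x \<cdot> p k) - g \<cdot> ?s k)"
      by (simp add: algebra_simps)
    also have "\<dots> = L \<cdot> (idt C Z - x \<cdot> p k) - L \<cdot> (g \<cdot> ?s k)"
      using cmp_diff_right[OF hom_diff[OF idt_in_hom xp] gs L] .
    finally have eq: "L \<cdot> (idt C Z - g \<cdot> ?s (Suc k)) = idt C Z - g' \<cdot> ?s k"
      using Lx cmp_assoc[OF sk g L] by (simp add: g'_def)
    have "?rad g'"
    proof (intro conjI allI impI ballI)
      fix j v assume j: "j < n" and v: "v \<in> hom C Z (Y j)"
      have gi: "g \<cdot> i j \<in> hom C (Y j) Z" using i[OF j] g by (rule cmp_in_hom)
      have vL: "v \<cdot> L \<in> hom C Z (Y j)" using L v by (rule cmp_in_hom)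
      have "v \<cdot> (g' \<cdot> i j) = v \<cdot> L \<cdot> (g \<cdot> i j)"
        using cmp_assoc[OF i[OF j] g L] cmp_assoc[OF gi L v] by (simp add: g'_def)
      then show "\<not> is_iso C (Y j) (Y j) (v \<cdot> (g' \<cdot> i j))" using Suc.prems j vL by simp
    qed (rule g')
    then obtain L' where L': "L' \<in> hom C Z Z" "L' \<cdot> (idt C Z - g' \<cdot> ?s k) = idt C Z"
      using Suc.IH[of g'] k by auto
    have "idt C Z - g \<cdot> ?s (Suc k) \<in> hom C Z Z"
      using cmp_in_hom[OF s[OF Suc.prems(1)] g] by simp
    then have "L' \<cdot> L \<cdot> (idt C Z - g \<cdot> ?s (Suc k)) = idt C Z"
      using cmp_assoc[OF _ L L'(1)] eq L'(2) by simp
    then show ?case using cmp_in_hom[OF L L'(1)] by blast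
  qed
  \<comment> \<open>The negated claim says that \<open>e\<close> satisfies \<open>?rad\<close>. But
    1 - e annihilates \<open>e\<close>, so a left inverse of it forces \<open>e = 0\<close>.\<close>
  from this[of n e] obtain L where L: "L \<in> hom C Z Z" "L \<cdot> (idt C Z - e) = idt C Z"
    using neg e ip by auto
  have "e = L \<cdot> (idt C Z - e) \<cdot> e" using L e by simp
  also have "\<dots> = L \<cdot> ((idt C Z - e) \<cdot> e)" using e L by (intro cmp_assoc[of _ Z Z _ Z _ Z]) auto
  also have "(idt C Z - e) \<cdot> e = 0" using e cmp_diff_left[of e Z Z "idt C Z" Z e] by simp
  finally show False using cmp_zero_right[OF L(1)] e by simp
qed

end

section \<open>Triangulated categories\<close>

context triangulated_category
begin

section \<open>The shift functor on morphisms\<close>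

lemma shm_in_hom: "f \<in> hom C X Y \<Longrightarrow> shm C f \<in> hom C (sh C X) (sh C Y)"
  using shm_bij[of X Y] by (auto simp: bij_betw_def)

lemma shm_zero [simp]: "shm C 0 = 0"
  using shm_add[of 0 undefined undefined 0] by simp

lemma shm_inject: "\<lbrakk>f \<in> hom C X Y; g \<in> hom C X Y\<rbrakk> \<Longrightarrow> shm C f = shm C g \<longleftrightarrow> f = g"
  using shm_bij[of X Y] by (auto simp: bij_betw_def inj_on_def)

lemma shm_eq_0: "f \<in> hom C X Y \<Longrightarrow> shm C f = 0 \<longleftrightarrow> f = 0"
  using shm_inject[of f X Y 0] by simp

lemma shm_surj:
  assumes "g \<in> hom C (sh C X) (sh C Y)"
  obtains f where "f \<in> hom C X Y" "g = shm C f"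
  using assms shm_bij[of X Y] by (auto simp: bij_betw_def)

lemma zero_object_sh: "zero_object C Z \<Longrightarrow> zero_object C (sh C Z)"
  by (metis zero_object_iff shm_idt shm_zero)

section \<open>Exactness of Hom on distinguished triangles, cocones and retracts\<close>

lemma tri_rotate: "tri C X Y Z f g h \<Longrightarrow> tri C Y Z (sh C X) g h (- shm C f)"
  using TR2 tri_in_hom by blast

text \<open>A morphism from the triangle on \<open>idt C X\<close> shows that
  \<open>g \<cdot> f\<close> factors through a zero object.\<close>

lemma tri_cmp_zero:
  assumes t: "tri C X Y Z f g h"
  shows "g \<cdot> f = 0"
proof -
  obtain N where N: "zero_object C N" using zero_object_exists by blast
  have H: "f \<in> hom C X Y" "g \<in> hom C Y Z" using tri_in_hom[OF t] by auto
  obtain c where "c \<in> hom C N Z" "c \<cdot> 0 = g \<cdot> f"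
    using TR3[OF TR1_idt[OF N] t idt_in_hom[of X] H(1)] H by auto
  then show ?thesis using cmp_zero_right by metis
qed

text \<open>TR3 between the rotated triangles W -> 0 -> W[1] and Y -> Z -> X[1] yields a morphism
  W[1] -> X[1], which is the shift of the required one.\<close>

lemma tri_weak_kernel:
  assumes t: "tri C X Y Z f g h" and y: "y \<in> hom C W Y" "g \<cdot> y = 0"
  obtains x where "x \<in> hom C W X" "y = f \<cdot> x"
proof -
  obtain N where N: "zero_object C N" using zero_object_exists by blast
  have H: "f \<in> hom C X Y" "g \<in> hom C Y Z" "h \<in> hom C Z (sh C X)" using tri_in_hom[OF t] by auto
  have W: "tri C W N (sh C W) 0 0 (- idt C (sh C W))"
    using tri_rotate[OF TR1_idt[OF N, of W]] by (simp add: shm_idt)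
  have "0 \<cdot> 0 = g \<cdot> y" using y(2) cmp_zero_left[of 0 N N] by simp
  then obtain c where c: "c \<in> hom C (sh C W) (sh C X)"
    and eq: "shm C y \<cdot> (- idt C (sh C W)) = - shm C f \<cdot> c"
    using TR3[OF W tri_rotate[OF t] y(1) hom_zero] by auto
  obtain x where x: "x \<in> hom C W X" "c = shm C x" using shm_surj[OF c] .
  have "shm C y = shm C f \<cdot> c"
    using eq cmp_uminus_right[OF idt_in_hom shm_in_hom[OF y(1)]]
      cmp_uminus_left[OF c shm_in_hom[OF H(1)]] shm_in_hom[OF y(1)] by simp
  also have "\<dots> = shm C (f \<cdot> x)" using shm_cmp[OF x(1) H(1)] x(2) by simp
  finally have "y = f \<cdot> x" using shm_inject[OF y(1) cmp_in_hom[OF x(1) H(1)]] by simp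
  with x(1) show thesis by (rule that)
qed

text \<open>TR3 into the triangle 0 -> W = W supplies the factorization in the third place.\<close>

lemma tri_weak_cokernel:
  assumes t: "tri C X Y Z f g h" and y: "y \<in> hom C Y W" "y \<cdot> f = 0"
  obtains z where "z \<in> hom C Z W" "y = z \<cdot> g"
proof -
  obtain N where N: "zero_object C N" using zero_object_exists by blast
  have W: "tri C N W W 0 (idt C W) 0"
    using TR2[of 0 N W "idt C W" W 0] TR1_idt[OF zero_object_sh[OF N], of W] by simp
  have H: "g \<in> hom C Y Z" using tri_in_hom[OF t] by auto
  have "y \<cdot> f = 0 \<cdot> 0" using y(2) cmp_zero_left[of 0 N N] by simp
  then obtain c where c: "c \<in> hom C Z W" "c \<cdot> g = idt C W \<cdot> y"
    using TR3[OF t W hom_zero y(1)] by auto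
  then show thesis using that y by auto
qed

text \<open>The cone of \<open>g\<close> is replaced by an isomorphic shift X[1], and the triangle
  is rotated back.\<close>

lemma tri_cocone:
  assumes g: "g \<in> hom C Y Z"
  obtains X f h where "tri C X Y Z f g h"
proof -
  obtain W a b where t: "tri C Y Z W g a b" using TR1_cone[OF g] by blast
  have H: "a \<in> hom C Z W" "b \<in> hom C W (sh C Y)" using tri_in_hom[OF t] by auto
  obtain X \<phi> where "is_iso C (sh C X) W \<phi>" using sh_ess_surj unfolding isomorphic_def by blast
  then obtain \<psi> where \<phi>: "\<phi> \<in> hom C (sh C X) W" and \<psi>: "\<psi> \<in> hom C W (sh C X)"
    and inv: "\<psi> \<cdot> \<phi> = idt C (sh C X)" "\<phi> \<cdot> \<psi> = idt C W" by (auto simp: is_iso_def)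
  have b\<phi>: "b \<cdot> \<phi> \<in> hom C (sh C X) (sh C Y)" using \<phi> H(2) by (rule cmp_in_hom)
  \<comment> \<open>The sign compensates for the one in \<open>TR2\<close>.\<close>
  obtain f where f: "f \<in> hom C X Y" "- (b \<cdot> \<phi>) = shm C f" using shm_surj[OF hom_uminus[OF b\<phi>]] .
  have h: "\<psi> \<cdot> a \<in> hom C Z (sh C X)" using H(1) \<psi> by (rule cmp_in_hom)
  have "tri C Y Z (sh C X) g (\<psi> \<cdot> a) (b \<cdot> \<phi>)"
  proof (rule TR1_iso[OF t g h b\<phi> is_iso_idt is_iso_idt])
    show "is_iso C W (sh C X) \<psi>" using \<phi> \<psi> inv by (auto simp: is_iso_def)
    show "shm C (idt C Y) \<cdot> b = b \<cdot> \<phi> \<cdot> \<psi>"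
      using cmp_assoc[OF \<psi> \<phi> H(2)] inv H(2) by (simp add: shm_idt)
  qed (use g h in simp_all)
  then have "tri C X Y Z f g (\<psi> \<cdot> a)"
    using TR2[OF f(1) g h] f(2) by (metis minus_minus)
  then show thesis by (rule that)
qed

text \<open>The complement is the cone \<open>Z\<close> of \<open>s\<close>: as \<open>s\<close> is
  a split monomorphism, the connecting map \<open>h\<close> vanishes, so \<open>g\<close> has a
  section.\<close>

lemma retract_direct_summand:
  assumes s: "s \<in> hom C Y X" and r: "r \<in> hom C X Y" and rs: "r \<cdot> s = idt C Y"
  shows "direct_summand C Y X"
proof -
  obtain Z g h where t: "tri C Y X Z s g h" using TR1_cone[OF s] by blast
  have g: "g \<in> hom C X Z" and h: "h \<in> hom C Z (sh C Y)" using tri_in_hom[OF t] by auto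
  note t' = tri_rotate[OF t]
  have "(- shm C s) \<cdot> h = 0" using tri_cmp_zero[OF tri_rotate[OF t']] .
  then have sh0: "shm C s \<cdot> h = 0" using cmp_uminus_left[OF h shm_in_hom[OF s]] by simp
  have "h = shm C (r \<cdot> s) \<cdot> h" using rs h by (simp add: shm_idt)
  also have "\<dots> = shm C r \<cdot> (shm C s \<cdot> h)"
    using shm_cmp[OF s r] cmp_assoc[OF h shm_in_hom[OF s] shm_in_hom[OF r]] by simp
  finally have "h = 0" using sh0 cmp_zero_right[OF shm_in_hom[OF r]] by simp
  then have "h \<cdot> idt C Z = 0" by (simp add: cmp_zero_left[of _ Z Z])
  then obtain q where q: "q \<in> hom C Z X" "idt C Z = g \<cdot> q"
    using tri_weak_kernel[OF t' idt_in_hom] by blast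
  have gs: "g \<cdot> s = 0" using tri_cmp_zero[OF t] .
  have rq: "r \<cdot> q \<in> hom C Z Y" using q(1) r by (rule cmp_in_hom)
  have srq: "s \<cdot> (r \<cdot> q) \<in> hom C Z X" using rq s by (rule cmp_in_hom)
  \<comment> \<open>The section \<open>q\<close> is corrected by its component along
    \<open>s\<close>, so that \<open>r\<close> annihilates it.\<close>
  define u where "u = q - s \<cdot> (r \<cdot> q)"
  have u: "u \<in> hom C Z X" using q srq by (simp add: u_def)
  have "r \<cdot> (s \<cdot> (r \<cdot> q)) = r \<cdot> q" using cmp_assoc[OF rq s r] rs rq by simp
  then have ru: "r \<cdot> u = 0" using cmp_diff_right[OF q(1) srq r] by (simp add: u_def)
  have "g \<cdot> (s \<cdot> (r \<cdot> q)) = 0" using cmp_assoc[OF rq s g] gs cmp_zero_left[OF rq] by simp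
  then have gu: "g \<cdot> u = idt C Z" using cmp_diff_right[OF q(1) srq g] q by (simp add: u_def)
  have sr: "s \<cdot> r \<in> hom C X X" and ug: "u \<cdot> g \<in> hom C X X"
    using s r u g by (auto intro: cmp_in_hom)
  \<comment> \<open>The defect \<open>d\<close> of the biproduct identity is annihilated by
    \<open>g\<close>, so it factors through \<open>s\<close>; it is also annihilated by
    \<open>r\<close>, so it is zero.\<close>
  define d where "d = idt C X - s \<cdot> r - u \<cdot> g"
  have d: "d \<in> hom C X X" using sr ug by (simp add: d_def)
  have "g \<cdot> d = g - g \<cdot> (s \<cdot> r) - g \<cdot> (u \<cdot> g)"
    unfolding d_def using sr ug g by (simp add: cmp_diff_right[of _ X X])
  also have "\<dots> = 0"
    using cmp_assoc[OF r s g] cmp_assoc[OF g u g] gs gu cmp_zero_left[OF r] g by simp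
  finally obtain y where y: "y \<in> hom C X Y" "d = s \<cdot> y" using tri_weak_kernel[OF t d] by blast
  have "r \<cdot> d = r - r \<cdot> (s \<cdot> r) - r \<cdot> (u \<cdot> g)"
    unfolding d_def using sr ug r by (simp add: cmp_diff_right[of _ X X])
  also have "\<dots> = 0"
    using cmp_assoc[OF r s r] cmp_assoc[OF g u r] rs ru cmp_zero_left[OF g] r by simp
  finally have "y = 0" using y cmp_assoc[OF y(1) s r] rs by simp
  then have "d = 0" using y cmp_zero_right[OF s] by simp
  then have id: "s \<cdot> r + u \<cdot> g = idt C X" by (simp add: d_def algebra_simps)
  have "direct_sum C [Y, Z] X"
    unfolding direct_sum_def
    by (rule exI[of _ "\<lambda>j. if j = 0 then s else u"], rule exI[of _ "\<lambda>j. if j = 0 then r else g"])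
      (use s r u g rs ru gs gu id in \<open>auto simp: less_Suc_eq lessThan_Suc add.commute\<close>)
  then show ?thesis unfolding direct_summand_def by blast
qed

end

section \<open>Cluster-tilting subcategories\<close>

locale cluster_tilting_subcategory = triangulated_category C
  for C :: "('o, 'm::ab_group_add, 'k::field, 'z) tri_cat_scheme" (structure) +
  fixes T :: "'o set"
  assumes ct: "cluster_tilting C T"
begin

section \<open>Rigidity, approximation triangles, weak kernels and the factor ideal\<close>

lemma T_summand: "\<lbrakk>X \<in> T; direct_summand C Y X\<rbrakk> \<Longrightarrow> Y \<in> T"
  using ct unfolding cluster_tilting_def closed_subcategory_def by blast

lemma T_rigid: "\<lbrakk>A \<in> T; B \<in> T; f \<in> hom C A (sh C B)\<rbrakk> \<Longrightarrow> f = 0"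
  using ct unfolding cluster_tilting_def by blast

lemma T_rigid_cmp:
  "\<lbrakk>A \<in> T; B \<in> T; f \<in> hom C A X; g \<in> hom C X (sh C B)\<rbrakk> \<Longrightarrow> g \<cdot> f = 0"
  using T_rigid cmp_in_hom by blast

text \<open>A map S -> A[1] with S in \<open>T\<close> becomes zero in B[1], so it comes from a map
  S -> X; that one lifts along the approximation, and \<open>h \<cdot> f = 0\<close>. Thus Hom(S,
  A[1]) = 0 for all such S, which characterizes \<open>A \<in> T\<close>.\<close>

lemma approximation_triangle:
  obtains A B d f h where "A \<in> T" "B \<in> T" "tri C A B X d f h" "right_approximation C T X B f"
proof -
  obtain B f where app: "right_approximation C T X B f"
    using ct unfolding cluster_tilting_def functorially_finite_def by blast
  then have B: "B \<in> T" and f: "f \<in> hom C B X" by (auto simp: right_approximation_def)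
  obtain A d h where t: "tri C A B X d f h" using tri_cocone[OF f] by blast
  have H: "d \<in> hom C A B" "h \<in> hom C X (sh C A)" using tri_in_hom[OF t] by auto
  note t1 = tri_rotate[OF t]
  note t2 = tri_rotate[OF t1]
  have "y = 0" if S: "S \<in> T" and y: "y \<in> hom C S (sh C A)" for S y
  proof -
    have "(- shm C d) \<cdot> y = 0"
      using T_rigid_cmp[OF S B y hom_uminus[OF shm_in_hom[OF H(1)]]] .
    then obtain x where x: "x \<in> hom C S X" "y = h \<cdot> x" using tri_weak_kernel[OF t2 y] by blast
    obtain z where z: "z \<in> hom C S B" "x = f \<cdot> z"
      using app S x(1) unfolding right_approximation_def by blast
    show "y = 0"
      using x z cmp_assoc[OF z(1) f H(2)] tri_cmp_zero[OF t1] cmp_zero_left[OF z(1)] by simp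
  qed
  then have "A \<in> T" using ct hom_zero unfolding cluster_tilting_def by blast
  then show thesis using that B t app by blast
qed

text \<open>A cocone of \<open>d\<close> is a weak kernel but need not lie in \<open>T\<close>; the
  source of a right approximation of it does, and maps from \<open>T\<close> still factor through
  it.\<close>

lemma weak_T_kernel:
  assumes d: "d \<in> hom C B X"
  obtains A k where "A \<in> T" "k \<in> hom C A B" "d \<cdot> k = 0"
    "\<And>S y. \<lbrakk>S \<in> T; y \<in> hom C S B; d \<cdot> y = 0\<rbrakk> \<Longrightarrow> \<exists>z \<in> hom C S A. y = k \<cdot> z"
proof -
  obtain W l q where t: "tri C W B X l d q" using tri_cocone[OF d] by blast
  have l: "l \<in> hom C W B" using tri_in_hom[OF t] by auto
  obtain A p where app: "right_approximation C T W A p"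
    using ct unfolding cluster_tilting_def functorially_finite_def by blast
  then have A: "A \<in> T" and p: "p \<in> hom C A W" by (auto simp: right_approximation_def)
  show thesis
  proof
    show "A \<in> T" by fact
    show "l \<cdot> p \<in> hom C A B" using p l by (rule cmp_in_hom)
    show "d \<cdot> (l \<cdot> p) = 0"
      using cmp_assoc[OF p l d] tri_cmp_zero[OF t] cmp_zero_left[OF p] by simp
    fix S y assume S: "S \<in> T" and y: "y \<in> hom C S B" "d \<cdot> y = 0"
    obtain x where x: "x \<in> hom C S W" "y = l \<cdot> x" using tri_weak_kernel[OF t y] .
    obtain z where z: "z \<in> hom C S A" "x = p \<cdot> z"
      using app S x(1) unfolding right_approximation_def by blast
    have "y = l \<cdot> p \<cdot> z" using x z(2) cmp_assoc[OF z(1) p l] by simp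
    with z(1) show "\<exists>z \<in> hom C S A. y = l \<cdot> p \<cdot> z" by blast
  qed
qed

text \<open>Objects of T[1] are only isomorphic to shifts; composing with these isomorphisms
  preserves nonvanishing, so literal shifts suffice.\<close>

lemma factor_ideal_nonzero_iff:
  "factor_ideal_nonzero C (shift_subcategory C T) X \<longleftrightarrow>
     (\<exists>A \<in> T. \<exists>B \<in> T. \<exists>g \<in> hom C (sh C A) X. \<exists>h \<in> hom C X (sh C B). h \<cdot> g \<noteq> 0)"
proof
  assume "factor_ideal_nonzero C (shift_subcategory C T) X"
  then obtain A' B' g h where U: "A' \<in> shift_subcategory C T" "B' \<in> shift_subcategory C T"
    and g: "g \<in> hom C A' X" and h: "h \<in> hom C X B'" and hg: "h \<cdot> g \<noteq> 0"
    unfolding factor_ideal_nonzero_def factor_ideal_def by blast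
  obtain A a a' where A: "A \<in> T" and a: "a \<in> hom C A' (sh C A)" "a' \<in> hom C (sh C A) A'"
    "a' \<cdot> a = idt C A'"
    using U(1) unfolding shift_subcategory_def isomorphic_def is_iso_def by blast
  obtain B b b' where B: "B \<in> T" and b: "b \<in> hom C B' (sh C B)" "b' \<in> hom C (sh C B) B'"
    "b' \<cdot> b = idt C B'"
    using U(2) unfolding shift_subcategory_def isomorphic_def is_iso_def by blast
  have ga: "g \<cdot> a' \<in> hom C (sh C A) X" and bh: "b \<cdot> h \<in> hom C X (sh C B)"
    using a b g h by (auto intro: cmp_in_hom)
  have "b' \<cdot> (b \<cdot> h) = h" using cmp_assoc[OF h b(1,2)] b h by simp
  moreover have "g \<cdot> a' \<cdot> a = g" using cmp_assoc[OF a(1,2) g] a g by simp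
  ultimately have "h \<cdot> g = b' \<cdot> (b \<cdot> h \<cdot> (g \<cdot> a')) \<cdot> a"
    using cmp_assoc[OF ga bh b(2)] cmp_assoc[OF a(1) ga h] by simp
  then have "b \<cdot> h \<cdot> (g \<cdot> a') \<noteq> 0"
    using hg cmp_zero_right[OF b(2)] cmp_zero_left[OF a(1)] by auto
  then show "\<exists>A \<in> T. \<exists>B \<in> T. \<exists>g \<in> hom C (sh C A) X. \<exists>h \<in> hom C X (sh C B). h \<cdot> g \<noteq> 0"
    using A B ga bh by blast
next
  assume "\<exists>A \<in> T. \<exists>B \<in> T. \<exists>g \<in> hom C (sh C A) X. \<exists>h \<in> hom C X (sh C B). h \<cdot> g \<noteq> 0"
  then obtain A B g h where AB: "A \<in> T" "B \<in> T" and g: "g \<in> hom C (sh C A) X"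
    and h: "h \<in> hom C X (sh C B)" and hg: "h \<cdot> g \<noteq> 0" by blast
  have "sh C A \<in> shift_subcategory C T" "sh C B \<in> shift_subcategory C T"
    using AB is_iso_idt unfolding shift_subcategory_def isomorphic_def by blast+
  then have "h \<cdot> g \<in> factor_ideal C (shift_subcategory C T) X (sh C A) (sh C B)"
    using cmp_in_hom[OF g h] g h unfolding factor_ideal_def by blast
  with hg show "factor_ideal_nonzero C (shift_subcategory C T) X"
    unfolding factor_ideal_nonzero_def by blast
qed

lemma factor_ideal_zero_iff_mono:
  assumes A: "A \<in> T" and t: "tri C A B X d f h" and app: "right_approximation C T X B f"
  shows "\<not> factor_ideal_nonzero C (shift_subcategory C T) X \<longleftrightarrow>
    (\<forall>S \<in> T. \<forall>m \<in> hom C S A. d \<cdot> m = 0 \<longrightarrow> m = 0)"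
proof -
  have d: "d \<in> hom C A B" and f: "f \<in> hom C B X" and h: "h \<in> hom C X (sh C A)"
    using tri_in_hom[OF t] by auto
  have B: "B \<in> T" using app by (simp add: right_approximation_def)
  note t1 = tri_rotate[OF t]
  note t2 = tri_rotate[OF t1]
  note sd = shm_in_hom[OF d]
  have sdh: "shm C d \<cdot> h = 0" using tri_cmp_zero[OF t2] cmp_uminus_left[OF h sd] by simp
  show ?thesis
  proof (intro iffI ballI impI)
    fix S m assume I: "\<not> factor_ideal_nonzero C (shift_subcategory C T) X"
      and S: "S \<in> T" and m: "m \<in> hom C S A" and dm: "d \<cdot> m = 0"
    note sm = shm_in_hom[OF m]
    \<comment> \<open>By exactness of the twice rotated triangle, the shift of a map annihilated by
      \<open>d\<close> is a composition S[1] -> X -> A[1], so it belongs to the ideal.\<close>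
    have "(- shm C d) \<cdot> shm C m = 0" using shm_cmp[OF m d] dm cmp_uminus_left[OF sm sd] by simp
    then obtain x where "x \<in> hom C (sh C S) X" "shm C m = h \<cdot> x"
      using tri_weak_kernel[OF t2 sm] by blast
    then have "shm C m = 0" using I A S h unfolding factor_ideal_nonzero_iff by auto
    then show "m = 0" using shm_eq_0[OF m] by simp
  next
    assume K: "\<forall>S \<in> T. \<forall>m \<in> hom C S A. d \<cdot> m = 0 \<longrightarrow> m = 0"
    have "k \<cdot> g = 0" if S: "S \<in> T" and R: "R \<in> T" and g: "g \<in> hom C (sh C S) X"
      and k: "k \<in> hom C X (sh C R)" for S R g k
    proof -
      \<comment> \<open>Rigidity makes \<open>k\<close> factor through \<open>h\<close>, so it
        suffices to show \<open>h \<cdot> g = 0\<close>.\<close>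
      have "k \<cdot> f = 0" using T_rigid_cmp[OF B R f k] .
      then obtain z where z: "z \<in> hom C (sh C A) (sh C R)" "k = z \<cdot> h"
        using tri_weak_cokernel[OF t1 k] by blast
      have hg: "h \<cdot> g \<in> hom C (sh C S) (sh C A)" using g h by (rule cmp_in_hom)
      obtain m where m: "m \<in> hom C S A" "h \<cdot> g = shm C m" using shm_surj[OF hg] .
      have "shm C (d \<cdot> m) = shm C d \<cdot> h \<cdot> g"
        using shm_cmp[OF m(1) d] m(2) cmp_assoc[OF g h sd] by simp
      also have "\<dots> = 0" using sdh cmp_zero_left[OF g] by simp
      finally have "m = 0" using K S m(1) shm_eq_0[OF cmp_in_hom[OF m(1) d]] by simp
      then show "k \<cdot> g = 0" using z m cmp_assoc[OF g h z(1)] cmp_zero_right[OF z(1)] by simp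
    qed
    then show "\<not> factor_ideal_nonzero C (shift_subcategory C T) X"
      unfolding factor_ideal_nonzero_iff by blast
  qed
qed

text \<open>If the sequence A \<open>\<rightarrow>\<close> B \<open>\<rightarrow>\<close> E \<open>\<rightarrow>\<close> G below comes from a projective resolution, splitting of
  A \<open>\<rightarrow>\<close> B onto its image means that the image of B \<open>\<rightarrow>\<close> E is projective. Hence the
  lemma says that a finite resolution can be shortened as long as it is longer than 1. The reason
  is that the connecting map \<open>h\<close> of the cone of \<open>d\<close> becomes zero after projecting away from the
  image of \<open>d''\<close>.\<close>

lemma splitting_descends:
  assumes T: "B \<in> T" "E \<in> T" "G \<in> T"
    and d'': "d'' \<in> hom C A B" and d: "d \<in> hom C B E" and d': "d' \<in> hom C E G"
    and dd: "d \<cdot> d'' = 0" "d' \<cdot> d = 0"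
    and exB: "\<And>S y. \<lbrakk>S \<in> T; y \<in> hom C S B; d \<cdot> y = 0\<rbrakk> \<Longrightarrow> \<exists>z \<in> hom C S A. y = d'' \<cdot> z"
    and exE: "\<And>S y. \<lbrakk>S \<in> T; y \<in> hom C S E; d' \<cdot> y = 0\<rbrakk> \<Longrightarrow> \<exists>z \<in> hom C S B. y = d \<cdot> z"
    and s: "s \<in> hom C B A" "d'' \<cdot> (s \<cdot> d'') = d''"
  shows "\<exists>s' \<in> hom C E B. d \<cdot> (s' \<cdot> d) = d"
proof -
  have d''s: "d'' \<cdot> s \<in> hom C B B" using s(1) d'' by (rule cmp_in_hom)
  define e where "e = idt C B - d'' \<cdot> s"
  have e: "e \<in> hom C B B" using d''s by (simp add: e_def)
  have ed'': "e \<cdot> d'' = 0"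
    unfolding e_def
    using cmp_diff_left[OF d'' idt_in_hom d''s] cmp_assoc[OF d'' s(1) d''] s(2) d'' by simp
  have de: "d \<cdot> e = d"
    unfolding e_def using cmp_diff_right[OF idt_in_hom d''s d] cmp_assoc[OF s(1) d'' d] dd(1)
      cmp_zero_left[OF s(1)] d by simp
  \<comment> \<open>A factorization \<open>s' \<cdot> d = e\<close> proves the claim because
    \<open>d \<cdot> e = d\<close>; it exists once \<open>shm C e \<cdot> h = 0\<close>.\<close>
  obtain Z g h where t: "tri C B E Z d g h" using TR1_cone[OF d] by blast
  have g: "g \<in> hom C E Z" and h: "h \<in> hom C Z (sh C B)" using tri_in_hom[OF t] by auto
  note t1 = tri_rotate[OF t]
  note t2 = tri_rotate[OF t1]
  note sd = shm_in_hom[OF d] and se = shm_in_hom[OF e]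
  obtain w where w: "w \<in> hom C Z G" "d' = w \<cdot> g" using tri_weak_cokernel[OF t d' dd(2)] .
  \<comment> \<open>\<open>W\<close> collects the maps into \<open>Z\<close> that die in
    \<open>G\<close>. Such a map from an object of \<open>T\<close> lifts to \<open>E\<close> by
    rigidity and then to \<open>B\<close> by exactness, so it is zero; this is tested on an
    approximation \<open>P\<close> of \<open>W\<close>.\<close>
  obtain W l r where tw: "tri C W Z G l w r" using tri_cocone[OF w(1)] by blast
  have l: "l \<in> hom C W Z" using tri_in_hom[OF tw] by auto
  obtain S0 P d0 p q where S0: "S0 \<in> T" and P: "P \<in> T" and tp: "tri C S0 P W d0 p q"
    and "right_approximation C T W P p"
    using approximation_triangle[of W] .
  have p: "p \<in> hom C P W" and q: "q \<in> hom C W (sh C S0)" using tri_in_hom[OF tp] by auto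
  have lp_in: "l \<cdot> p \<in> hom C P Z" using p l by (rule cmp_in_hom)
  have "h \<cdot> (l \<cdot> p) = 0" using T_rigid_cmp[OF P T(1) lp_in h] .
  then obtain y where y: "y \<in> hom C P E" "l \<cdot> p = g \<cdot> y" using tri_weak_kernel[OF t1 lp_in] by blast
  have "d' \<cdot> y = w \<cdot> (l \<cdot> p)" using w y cmp_assoc[OF y(1) g w(1)] by simp
  also have "\<dots> = 0"
    using cmp_assoc[OF p l w(1)] tri_cmp_zero[OF tw] cmp_zero_left[OF p] by simp
  finally obtain y' where y': "y' \<in> hom C P B" "y = d \<cdot> y'" using exE[OF P y(1)] by blast
  have lp: "l \<cdot> p = 0"
    using y y' cmp_assoc[OF y'(1) d g] tri_cmp_zero[OF t] cmp_zero_left[OF y'(1)] by simp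
  \<comment> \<open>So \<open>l\<close> factors through S0[1], and there \<open>h\<close> becomes
    the shift of a map \<open>m\<close> annihilated by \<open>d\<close>. Exactness puts
    \<open>m\<close> into the image of \<open>d''\<close>, which \<open>e\<close>
    annihilates.\<close>
  obtain k where k: "k \<in> hom C (sh C S0) Z" "l = k \<cdot> q"
    using tri_weak_cokernel[OF tri_rotate[OF tp] l lp] .
  have hk: "h \<cdot> k \<in> hom C (sh C S0) (sh C B)" using k(1) h by (rule cmp_in_hom)
  obtain m where m: "m \<in> hom C S0 B" "h \<cdot> k = shm C m" using shm_surj[OF hk] .
  have "shm C d \<cdot> h = 0" using tri_cmp_zero[OF t2] cmp_uminus_left[OF h sd] by simp
  then have "shm C (d \<cdot> m) = 0"
    using shm_cmp[OF m(1) d] m(2) cmp_assoc[OF k(1) h sd] cmp_zero_left[OF k(1)] by simp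
  then have "d \<cdot> m = 0" using shm_eq_0[OF cmp_in_hom[OF m(1) d]] by simp
  then obtain m' where m': "m' \<in> hom C S0 A" "m = d'' \<cdot> m'" using exB[OF S0 m(1)] by blast
  have em: "e \<cdot> m = 0" using m' cmp_assoc[OF m'(1) d'' e] ed'' cmp_zero_left[OF m'(1)] by simp
  have eh: "shm C e \<cdot> h \<in> hom C Z (sh C B)" using h se by (rule cmp_in_hom)
  have "shm C e \<cdot> h \<cdot> l = shm C e \<cdot> h \<cdot> k \<cdot> q" using k cmp_assoc[OF q k(1) eh] by simp
  also have "shm C e \<cdot> h \<cdot> k = shm C (e \<cdot> m)"
    using cmp_assoc[OF k(1) h se] m shm_cmp[OF m(1) e] by simp
  finally have "shm C e \<cdot> h \<cdot> l = 0" using em cmp_zero_left[OF q] by simp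
  \<comment> \<open>Hence \<open>shm C e \<cdot> h\<close> factors through \<open>w\<close>, and
    rigidity kills the remaining map G -> B[1].\<close>
  then obtain z where z: "z \<in> hom C G (sh C B)" "shm C e \<cdot> h = z \<cdot> w"
    using tri_weak_cokernel[OF tw eh] by blast
  have "z = 0" using T_rigid[OF T(3,1) z(1)] .
  then have "shm C e \<cdot> h = 0" using z cmp_zero_left[OF w(1)] by simp
  then obtain z' where z': "z' \<in> hom C (sh C E) (sh C B)" "shm C e = z' \<cdot> (- shm C d)"
    using tri_weak_cokernel[OF t2 se] by blast
  obtain s' where s': "s' \<in> hom C E B" "- z' = shm C s'" using shm_surj[OF hom_uminus[OF z'(1)]] .
  have "shm C (s' \<cdot> d) = shm C e"
    using shm_cmp[OF d s'(1)] s'(2) z' cmp_uminus_left[OF sd z'(1)] cmp_uminus_right[OF sd z'(1)]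
    by simp
  then have "s' \<cdot> d = e" using shm_inject[OF cmp_in_hom[OF d s'(1)] e] by simp
  then show ?thesis using s'(1) de by auto
qed

text \<open>Up to isomorphism \<open>X\<close> is a shift B[1]; pulling the retraction back along
  the shift exhibits \<open>B\<close> as a retract of an object of \<open>T\<close>.\<close>

lemma shift_subcategory_retract:
  assumes Y: "Y \<in> shift_subcategory C T" and a: "a \<in> hom C X Y" and b: "b \<in> hom C Y X"
    and ba: "b \<cdot> a = idt C X"
  shows "X \<in> shift_subcategory C T"
proof -
  obtain A \<phi> \<phi>' where A: "A \<in> T" and \<phi>: "\<phi> \<in> hom C Y (sh C A)" "\<phi>' \<in> hom C (sh C A) Y"
    "\<phi>' \<cdot> \<phi> = idt C Y"
    using Y unfolding shift_subcategory_def isomorphic_def is_iso_def by blast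
  obtain B \<psi> \<psi>' where \<psi>: "\<psi> \<in> hom C (sh C B) X" "\<psi>' \<in> hom C X (sh C B)"
    "\<psi>' \<cdot> \<psi> = idt C (sh C B)" "\<psi> \<cdot> \<psi>' = idt C X"
    using sh_ess_surj[of X] unfolding isomorphic_def is_iso_def by blast
  have a\<psi>: "a \<cdot> \<psi> \<in> hom C (sh C B) Y" using \<psi>(1) a by (rule cmp_in_hom)
  have \<psi>b: "\<psi>' \<cdot> b \<in> hom C Y (sh C B)" using b \<psi>(2) by (rule cmp_in_hom)
  have u: "\<phi> \<cdot> (a \<cdot> \<psi>) \<in> hom C (sh C B) (sh C A)" using a\<psi> \<phi>(1) by (rule cmp_in_hom)
  obtain \<alpha> where \<alpha>: "\<alpha> \<in> hom C B A" "\<phi> \<cdot> (a \<cdot> \<psi>) = shm C \<alpha>" using shm_surj[OF u] .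
  obtain \<beta> where \<beta>: "\<beta> \<in> hom C A B" "\<psi>' \<cdot> b \<cdot> \<phi>' = shm C \<beta>"
    using shm_surj[OF cmp_in_hom[OF \<phi>(2) \<psi>b]] .
  have "shm C (\<beta> \<cdot> \<alpha>) = \<psi>' \<cdot> b \<cdot> (\<phi>' \<cdot> (\<phi> \<cdot> (a \<cdot> \<psi>)))"
    using shm_cmp[OF \<alpha>(1) \<beta>(1)] \<alpha>(2) \<beta>(2) cmp_assoc[OF u \<phi>(2) \<psi>b] by simp
  also have "\<phi>' \<cdot> (\<phi> \<cdot> (a \<cdot> \<psi>)) = a \<cdot> \<psi>" using cmp_assoc[OF a\<psi> \<phi>(1,2)] \<phi>(3) a\<psi> by simp
  also have "\<psi>' \<cdot> b \<cdot> (a \<cdot> \<psi>) = \<psi>' \<cdot> (b \<cdot> a \<cdot> \<psi>)"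
    using cmp_assoc[OF a\<psi> b \<psi>(2)] cmp_assoc[OF \<psi>(1) a b] by simp
  also have "\<dots> = shm C (idt C B)" using ba \<psi> by (simp add: shm_idt)
  finally have "\<beta> \<cdot> \<alpha> = idt C B"
    using shm_inject[OF cmp_in_hom[OF \<alpha>(1) \<beta>(1)] idt_in_hom] by simp
  then have "B \<in> T" using T_summand[OF A] retract_direct_summand[OF \<alpha>(1) \<beta>(1)] by blast
  moreover have "isomorphic C X (sh C B)" using \<psi> unfolding isomorphic_def is_iso_def by blast
  ultimately show ?thesis unfolding shift_subcategory_def by blast
qed

end

section \<open>Krull-Schmidt categories\<close>

lemma direct_sumE:
  assumes "direct_sum C Xs S"
  obtains i p where "\<forall>j < length Xs. i j \<in> hom C (Xs ! j) S"
    "\<forall>j < length Xs. p j \<in> hom C S (Xs ! j)"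
    "\<forall>j < length Xs. \<forall>l < length Xs. p j \<cdot>\<^bsub>C\<^esub> i l = (if j = l then idt C (Xs ! j) else 0)"
    "(\<Sum>j < length Xs. i j \<cdot>\<^bsub>C\<^esub> p j) = idt C S"
  using assms unfolding direct_sum_def by blast

lemma direct_sum_pairE:
  assumes "direct_sum C [X, Y] S"
  obtains a b p q where "a \<in> hom C X S" "b \<in> hom C Y S" "p \<in> hom C S X" "q \<in> hom C S Y"
    "p \<cdot>\<^bsub>C\<^esub> a = idt C X" "a \<cdot>\<^bsub>C\<^esub> p + b \<cdot>\<^bsub>C\<^esub> q = idt C S"
proof -
  obtain i p where ip_all: "\<forall>j < length [X, Y]. i j \<in> hom C ([X, Y] ! j) S"
    "\<forall>j < length [X, Y]. p j \<in> hom C S ([X, Y] ! j)"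
    "\<forall>j < length [X, Y]. \<forall>l < length [X, Y]. p j \<cdot>\<^bsub>C\<^esub> i l = (if j = l then idt C ([X, Y] ! j) else 0)"
    "(\<Sum>j < length [X, Y]. i j \<cdot>\<^bsub>C\<^esub> p j) = idt C S"
    using direct_sumE[OF assms] .
  note ip = ip_all(1-3)[rule_format] ip_all(4)
  show thesis
    using that[of "i 0" "i 1" "p 0" "p 1"] ip(1,2)[of 0] ip(1,2)[of 1] ip(3)[of 0 0] ip(4)
    by (simp add: lessThan_Suc add.commute)
qed

context triangulated_category
begin

lemma local_end_not_zero: "local_end C X \<Longrightarrow> \<not> zero_object C X"
  by (simp add: local_end_def zero_object_iff)

text \<open>A Krull-Schmidt decomposition of the nonzero object \<open>X\<close> has a first
  summand; by indecomposability its complement is zero, so \<open>X\<close> is isomorphic to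
  it.\<close>

lemma indecomposable_local_end:
  assumes ks: "krull_schmidt C" and X: "indecomposable C X"
  shows "local_end C X"
proof -
  obtain Xs where loc: "\<forall>Y \<in> set Xs. local_end C Y" and ds: "direct_sum C Xs X"
    using ks unfolding krull_schmidt_def by blast
  obtain i p where ip_all: "\<forall>j < length Xs. i j \<in> hom C (Xs ! j) X"
      "\<forall>j < length Xs. p j \<in> hom C X (Xs ! j)"
      "\<forall>j < length Xs. \<forall>l < length Xs. p j \<cdot> i l = (if j = l then idt C (Xs ! j) else 0)"
      "(\<Sum>j < length Xs. i j \<cdot> p j) = idt C X"
    using direct_sumE[OF ds] .
  note ip = ip_all(1-3)[rule_format] ip_all(4)
  have "Xs \<noteq> []"
  proof
    assume "Xs = []"
    then have "idt C X = 0" using ip(4) by simp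
    then show False using X by (simp add: indecomposable_def zero_object_iff)
  qed
  then have len: "0 < length Xs" by simp
  define Y where "Y = Xs ! 0"
  have Y: "local_end C Y" using loc len by (simp add: Y_def)
  have "p 0 \<cdot> i 0 = idt C Y" using ip(3)[OF len len] by (simp add: Y_def)
  then obtain Y' where ds': "direct_sum C [Y, Y'] X"
    using retract_direct_summand[of "i 0" Y X "p 0"] ip(1,2)[OF len]
    by (auto simp: Y_def direct_summand_def)
  then have Y': "zero_object C Y'"
    using X local_end_not_zero[OF Y] unfolding indecomposable_def by blast
  obtain u u' q q' where uq: "u \<in> hom C Y X" "u' \<in> hom C Y' X" "q \<in> hom C X Y" "q' \<in> hom C X Y'"
      "q \<cdot> u = idt C Y" "u \<cdot> q + u' \<cdot> q' = idt C X"
    using direct_sum_pairE[OF ds'] .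
  have "u' = 0" using Y' uq(2) by (auto simp: zero_object_def)
  then have "u \<cdot> q = idt C X" using uq(6) cmp_zero_left[OF uq(4)] by simp
  then show ?thesis using local_end_transfer[OF Y uq(1,3,5)] by blast
qed

end

text \<open>Positions are tracked rather than entries because summands may repeat; this matches the
  biproduct of the retained summands with that of all summands.\<close>

lemma filter_nth_bij:
  obtains \<sigma> where
    "bij_betw \<sigma> {..<length (filter P xs)} {j. j < length xs \<and> P (xs ! j)}"
    "\<And>k. k < length (filter P xs) \<Longrightarrow> filter P xs ! k = xs ! \<sigma> k"
proof
  define js where "js = filter (\<lambda>j. P (xs ! j)) [0..<length xs]"
  have f: "filter P xs = map (nth xs) js"
    using filter_map[of P "nth xs" "[0..<length xs]"] by (simp add: map_nth js_def comp_def)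
  show "bij_betw (nth js) {..<length (filter P xs)} {j. j < length xs \<and> P (xs ! j)}"
    by (rule bij_betw_nth) (auto simp: f, auto simp: js_def)
  show "filter P xs ! k = xs ! (js ! k)" if "k < length (filter P xs)" for k
    using that by (simp add: f)
qed

section \<open>Removing the summands in T[1]\<close>

context cluster_tilting_subcategory
begin

text \<open>A nonzero summand \<open>Y\<close> in T[1] defines a nonzero idempotent
  \<open>a \<cdot> b\<close>, which is invertible through some retained summand. That summand is
  then a retract of \<open>Y\<close> and lies in T[1], contrary to the filtering.\<close>

lemma reduced_part_no_summands:
  assumes ks: "krull_schmidt C" and red: "reduced_part C (shift_subcategory C T) X X'"
  shows "no_summands_in C (shift_subcategory C T) X'"
  unfolding no_summands_in_def
proof (intro ballI impI, rule ccontr)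
  let ?U = "shift_subcategory C T"
  fix Y assume Y: "Y \<in> ?U" and sY: "direct_summand C Y X'" and nz: "\<not> zero_object C Y"
  obtain Xs where ind: "\<forall>A \<in> set Xs. indecomposable C A"
    and ds: "direct_sum C (filter (\<lambda>A. A \<notin> ?U) Xs) X'"
    using red unfolding reduced_part_def by blast
  define Ys where "Ys = filter (\<lambda>A. A \<notin> ?U) Xs"
  obtain i p where ip_all: "\<forall>j < length Ys. i j \<in> hom C (Ys ! j) X'"
      "\<forall>j < length Ys. p j \<in> hom C X' (Ys ! j)"
      "\<forall>j < length Ys. \<forall>l < length Ys. p j \<cdot> i l = (if j = l then idt C (Ys ! j) else 0)"
      "(\<Sum>j < length Ys. i j \<cdot> p j) = idt C X'"
    using direct_sumE[OF ds[folded Ys_def]] .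
  note ip = ip_all(1-3)[rule_format] ip_all(4)
  have loc: "local_end C (Ys ! j)" "Ys ! j \<notin> ?U" if "j < length Ys" for j
    using nth_mem[OF that] indecomposable_local_end[OF ks] ind by (auto simp: Ys_def)
  obtain a b where a: "a \<in> hom C Y X'" and b: "b \<in> hom C X' Y" and ba: "b \<cdot> a = idt C Y"
    using sY unfolding direct_summand_def by (blast elim: direct_sum_pairE)
  have e: "a \<cdot> b \<in> hom C X' X'" using b a by (rule cmp_in_hom)
  have eid: "a \<cdot> b \<cdot> (a \<cdot> b) = a \<cdot> b" using cmp_assoc[OF e b a] cmp_assoc[OF b a b] ba b by simp
  have "a \<cdot> b \<noteq> 0"
  proof
    assume "a \<cdot> b = 0"
    then have "b \<cdot> (a \<cdot> b) \<cdot> a = 0" using cmp_zero_right[OF b] cmp_zero_left[OF a] by simp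
    then show False using cmp_assoc[OF b a b] b a ba nz by (simp add: zero_object_iff)
  qed
  then obtain j v where j: "j < length Ys" and v: "v \<in> hom C X' (Ys ! j)"
    and iso: "is_iso C (Ys ! j) (Ys ! j) (v \<cdot> (a \<cdot> b \<cdot> i j))"
    using idempotent_local_summand[OF loc(1) ip(1,2,4) e eid] by blast
  obtain w where w: "w \<in> hom C (Ys ! j) (Ys ! j)"
    and wv: "w \<cdot> (v \<cdot> (a \<cdot> b \<cdot> i j)) = idt C (Ys ! j)"
    using iso unfolding is_iso_def by blast
  have bi: "b \<cdot> i j \<in> hom C (Ys ! j) Y" using ip(1)[OF j] b by (rule cmp_in_hom)
  have va: "v \<cdot> a \<in> hom C Y (Ys ! j)" using a v by (rule cmp_in_hom)
  have "w \<cdot> (v \<cdot> a) \<cdot> (b \<cdot> i j) = w \<cdot> (v \<cdot> a \<cdot> (b \<cdot> i j))" using cmp_assoc[OF bi va w] .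
  also have "v \<cdot> a \<cdot> (b \<cdot> i j) = v \<cdot> (a \<cdot> b \<cdot> i j)"
    using cmp_assoc[OF bi a v] cmp_assoc[OF ip(1)[OF j] b a] by simp
  finally have "w \<cdot> (v \<cdot> a) \<cdot> (b \<cdot> i j) = idt C (Ys ! j)" using wv by simp
  then have "Ys ! j \<in> ?U" using shift_subcategory_retract[OF Y bi cmp_in_hom[OF va w]] by blast
  then show False using loc(2)[OF j] by blast
qed

text \<open>The summands in T[1] are invisible to morphisms from T.\<close>

lemma reduced_part_maps:
  assumes red: "reduced_part C (shift_subcategory C T) X X'"
  obtains u v where "u \<in> hom C X' X" "v \<in> hom C X X'" "v \<cdot> u = idt C X'"
    "\<And>S x. \<lbrakk>S \<in> T; x \<in> hom C S X\<rbrakk> \<Longrightarrow> u \<cdot> (v \<cdot> x) = x"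
proof -
  let ?U = "shift_subcategory C T"
  obtain Xs where dsX: "direct_sum C Xs X" and ds': "direct_sum C (filter (\<lambda>A. A \<notin> ?U) Xs) X'"
    using red unfolding reduced_part_def by blast
  define Ys where "Ys = filter (\<lambda>A. A \<notin> ?U) Xs"
  obtain \<sigma> where \<sigma>: "bij_betw \<sigma> {..<length Ys} {j. j < length Xs \<and> Xs ! j \<notin> ?U}"
    and \<sigma>_nth: "\<And>k. k < length Ys \<Longrightarrow> Ys ! k = Xs ! \<sigma> k"
    using filter_nth_bij[of "\<lambda>A. A \<notin> ?U" Xs] unfolding Ys_def by blast
  have \<sigma>_less: "\<sigma> k < length Xs" if "k < length Ys" for k
    using \<sigma> that by (auto simp: bij_betw_def)
  have \<sigma>_inj: "\<sigma> k = \<sigma> l \<longleftrightarrow> k = l" if "k < length Ys" "l < length Ys" for k l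
    using \<sigma> that by (auto simp: bij_betw_def inj_on_def)
  obtain i p where ip_all: "\<forall>j < length Xs. i j \<in> hom C (Xs ! j) X"
      "\<forall>j < length Xs. p j \<in> hom C X (Xs ! j)"
      "\<forall>j < length Xs. \<forall>l < length Xs. p j \<cdot> i l = (if j = l then idt C (Xs ! j) else 0)"
      "(\<Sum>j < length Xs. i j \<cdot> p j) = idt C X"
    using direct_sumE[OF dsX] .
  note ip = ip_all(1-3)[rule_format] ip_all(4)
  obtain a q where aq_all: "\<forall>j < length Ys. a j \<in> hom C (Ys ! j) X'"
      "\<forall>j < length Ys. q j \<in> hom C X' (Ys ! j)"
      "\<forall>j < length Ys. \<forall>l < length Ys. q j \<cdot> a l = (if j = l then idt C (Ys ! j) else 0)"
      "(\<Sum>j < length Ys. a j \<cdot> q j) = idt C X'"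
    using direct_sumE[OF ds'[folded Ys_def]] .
  note aq = aq_all(1-3)[rule_format] aq_all(4)
  have i\<sigma>: "i (\<sigma> k) \<in> hom C (Ys ! k) X" and p\<sigma>: "p (\<sigma> k) \<in> hom C X (Ys ! k)"
    if "k < length Ys" for k
    using ip(1,2)[OF \<sigma>_less[OF that]] \<sigma>_nth[OF that] by auto
  have pi\<sigma>: "p (\<sigma> k) \<cdot> i (\<sigma> l) = (if k = l then idt C (Ys ! k) else 0)"
    if "k < length Ys" "l < length Ys" for k l
    using ip(3)[OF \<sigma>_less[OF that(1)] \<sigma>_less[OF that(2)]] \<sigma>_nth[OF that(1)] \<sigma>_inj[OF that] by auto
  \<comment> \<open>\<open>u\<close> and \<open>v\<close> identify the summand of \<open>X'\<close>
    at position \<open>k\<close> with the summand of \<open>X\<close> at position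
    \<open>\<sigma> k\<close>.\<close>
  define u where "u = (\<Sum>k<length Ys. i (\<sigma> k) \<cdot> q k)"
  define v where "v = (\<Sum>k<length Ys. a k \<cdot> p (\<sigma> k))"
  have iq: "i (\<sigma> k) \<cdot> q k \<in> hom C X' X" and ap: "a k \<cdot> p (\<sigma> k) \<in> hom C X X'"
    if "k < length Ys" for k
    using cmp_in_hom[OF aq(2) i\<sigma>] cmp_in_hom[OF p\<sigma> aq(1)] that by auto
  have u: "u \<in> hom C X' X" unfolding u_def using iq by (intro hom_sum) auto
  have v: "v \<in> hom C X X'" unfolding v_def using ap by (intro hom_sum) auto
  have qv: "q k \<cdot> v = p (\<sigma> k)" if k: "k < length Ys" for k
  proof -
    have "q k \<cdot> v = (\<Sum>l<length Ys. q k \<cdot> (a l \<cdot> p (\<sigma> l)))"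
      unfolding v_def using ap aq(2)[OF k] by (intro cmp_sum_right[of _ _ X X']) auto
    also have "\<dots> = (\<Sum>l<length Ys. if l = k then p (\<sigma> k) else 0)"
    proof (intro sum.cong refl)
      fix l assume "l \<in> {..<length Ys}"
      then have l: "l < length Ys" by simp
      have "q k \<cdot> (a l \<cdot> p (\<sigma> l)) = q k \<cdot> a l \<cdot> p (\<sigma> l)"
        using cmp_assoc[OF p\<sigma>[OF l] aq(1)[OF l] aq(2)[OF k]] by simp
      then show "q k \<cdot> (a l \<cdot> p (\<sigma> l)) = (if l = k then p (\<sigma> k) else 0)"
        using aq(3)[OF k l] p\<sigma>[OF l] cmp_zero_left[OF p\<sigma>[OF l]] by auto
    qed
    finally show ?thesis using k by simp
  qed
  have pu: "p (\<sigma> k) \<cdot> u = q k" if k: "k < length Ys" for k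
  proof -
    have "p (\<sigma> k) \<cdot> u = (\<Sum>l<length Ys. p (\<sigma> k) \<cdot> (i (\<sigma> l) \<cdot> q l))"
      unfolding u_def using iq p\<sigma>[OF k] by (intro cmp_sum_right[of _ _ X' X]) auto
    also have "\<dots> = (\<Sum>l<length Ys. if l = k then q k else 0)"
    proof (intro sum.cong refl)
      fix l assume "l \<in> {..<length Ys}"
      then have l: "l < length Ys" by simp
      have "p (\<sigma> k) \<cdot> (i (\<sigma> l) \<cdot> q l) = p (\<sigma> k) \<cdot> i (\<sigma> l) \<cdot> q l"
        using cmp_assoc[OF aq(2)[OF l] i\<sigma>[OF l] p\<sigma>[OF k]] by simp
      then show "p (\<sigma> k) \<cdot> (i (\<sigma> l) \<cdot> q l) = (if l = k then q k else 0)"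
        using pi\<sigma>[OF k l] aq(2)[OF l] cmp_zero_left[OF aq(2)[OF l]] by auto
    qed
    finally show ?thesis using k by simp
  qed
  have "v \<cdot> u = (\<Sum>k<length Ys. a k \<cdot> p (\<sigma> k) \<cdot> u)"
    unfolding v_def using ap u by (intro cmp_sum_left[of _ _ X X']) auto
  also have "\<dots> = (\<Sum>k<length Ys. a k \<cdot> q k)"
    using cmp_assoc[OF u p\<sigma> aq(1)] pu by (intro sum.cong) auto
  finally have vu: "v \<cdot> u = idt C X'" using aq(4) by simp
  \<comment> \<open>\<open>u \<cdot> v\<close> projects \<open>X\<close> onto the retained summands;
    the missing terms annihilate every map from \<open>T\<close> by rigidity.\<close>
  have "u \<cdot> v = (\<Sum>k<length Ys. i (\<sigma> k) \<cdot> q k \<cdot> v)"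
    unfolding u_def using iq v by (intro cmp_sum_left[of _ _ X' X]) auto
  also have "\<dots> = (\<Sum>k<length Ys. i (\<sigma> k) \<cdot> p (\<sigma> k))"
    using cmp_assoc[OF v aq(2) i\<sigma>] qv by (intro sum.cong) auto
  also have "\<dots> = (\<Sum>j | j < length Xs \<and> Xs ! j \<notin> ?U. i j \<cdot> p j)"
    using sum.reindex_bij_betw[OF \<sigma>, of "\<lambda>j. i j \<cdot> p j"] by simp
  finally have uv: "u \<cdot> v = (\<Sum>j | j < length Xs \<and> Xs ! j \<notin> ?U. i j \<cdot> p j)" .
  have uvx: "u \<cdot> (v \<cdot> x) = x" if S: "S \<in> T" and x: "x \<in> hom C S X" for S x
  proof -
    have ipX: "i j \<cdot> p j \<in> hom C X X" if "j < length Xs" for j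
      using cmp_in_hom[OF ip(2,1)] that by auto
    have zero: "i j \<cdot> p j \<cdot> x = 0" if j: "j < length Xs" and U: "Xs ! j \<in> ?U" for j
    proof -
      obtain A \<phi> \<phi>' where A: "A \<in> T" and \<phi>: "\<phi> \<in> hom C (Xs ! j) (sh C A)"
        "\<phi>' \<in> hom C (sh C A) (Xs ! j)" "\<phi>' \<cdot> \<phi> = idt C (Xs ! j)"
        using U unfolding shift_subcategory_def isomorphic_def is_iso_def by blast
      have px: "p j \<cdot> x \<in> hom C S (Xs ! j)" using x ip(2)[OF j] by (rule cmp_in_hom)
      have "\<phi> \<cdot> (p j \<cdot> x) = 0" using T_rigid_cmp[OF S A px \<phi>(1)] .
      then have "p j \<cdot> x = 0" using cmp_assoc[OF px \<phi>(1,2)] \<phi>(3) px cmp_zero_right[OF \<phi>(2)] by simp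
      then show ?thesis using cmp_assoc[OF x ip(2)[OF j] ip(1)[OF j]] cmp_zero_right[OF ip(1)[OF j]]
        by simp
    qed
    have "x = (\<Sum>j<length Xs. i j \<cdot> p j) \<cdot> x" using ip(4) x by simp
    also have "\<dots> = (\<Sum>j<length Xs. i j \<cdot> p j \<cdot> x)"
      using ipX x by (intro cmp_sum_left[of _ _ X X]) auto
    also have "\<dots> = (\<Sum>j | j < length Xs \<and> Xs ! j \<notin> ?U. i j \<cdot> p j \<cdot> x)"
      using zero by (intro sum.mono_neutral_right) auto
    also have "\<dots> = u \<cdot> v \<cdot> x"
      unfolding uv using ipX x by (intro cmp_sum_left[of _ _ X X, symmetric]) auto
    finally show ?thesis using cmp_assoc[OF x v u] by simp
  qed
  show thesis using that[OF u v vu uvx] .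
qed

end

section \<open>Projective resolutions\<close>

lemma pd_infinite_iff: "pd C T F = \<infinity> \<longleftrightarrow> \<not> (\<exists>n P d. projective_resolution C T F n P d)"
proof
  assume inf: "pd C T F = \<infinity>"
  show "\<not> (\<exists>n P d. projective_resolution C T F n P d)"
  proof
    assume "\<exists>n P d. projective_resolution C T F n P d"
    then obtain n where "enat n \<in> {enat n | n. \<exists>P d. projective_resolution C T F n P d}" by blast
    then have "pd C T F \<le> enat n" unfolding pd_def by (rule Inf_lower)
    then show False using inf by simp
  qed
next
  assume "\<not> (\<exists>n P d. projective_resolution C T F n P d)"
  then have "{enat n | n. \<exists>P d. projective_resolution C T F n P d} = {}" by blast
  then show "pd C T F = \<infinity>" by (simp only: pd_def Inf_empty top_enat_def)
qed

lemma nat_transf_in: "\<lbrakk>nat_transf C T F G \<eta>; A \<in> T; x \<in> fob F A\<rbrakk> \<Longrightarrow> \<eta> A x \<in> fob G A"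
  unfolding nat_transf_def by blast

lemma nat_transf_add:
  "\<lbrakk>nat_transf C T F G \<eta>; A \<in> T; x \<in> fob F A; y \<in> fob F A\<rbrakk> \<Longrightarrow> \<eta> A (x + y) = \<eta> A x + \<eta> A y"
  unfolding nat_transf_def by blast

lemma nat_transf_natural:
  "\<lbrakk>nat_transf C T F G \<eta>; A \<in> T; B \<in> T; f \<in> hom C A B; x \<in> fob F B\<rbrakk>
    \<Longrightarrow> \<eta> A (fmor F A B f x) = fmor G A B f (\<eta> B x)"
  unfolding nat_transf_def by blast

lemma nat_transf_comp:
  assumes "nat_transf C T F G \<alpha>" "nat_transf C T G K \<beta>"
  shows "nat_transf C T F K (\<lambda>S x. \<beta> S (\<alpha> S x))"
  using assms unfolding nat_transf_def by simp

lemma additive_functor_zero: "\<lbrakk>additive_functor C T F; A \<in> T\<rbrakk> \<Longrightarrow> 0 \<in> fob F A"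
  unfolding additive_functor_def by blast

lemma fmor_in:
  "\<lbrakk>additive_functor C T F; A \<in> T; B \<in> T; f \<in> hom C A B; x \<in> fob F B\<rbrakk>
    \<Longrightarrow> fmor F A B f x \<in> fob F A"
  unfolding additive_functor_def by blast

lemma fmor_add_left:
  "\<lbrakk>additive_functor C T F; A \<in> T; B \<in> T; f \<in> hom C A B; f' \<in> hom C A B; x \<in> fob F B\<rbrakk>
    \<Longrightarrow> fmor F A B (f + f') x = fmor F A B f x + fmor F A B f' x"
  unfolding additive_functor_def by blast

lemma fmor_cmp:
  "\<lbrakk>additive_functor C T F; A \<in> T; B \<in> T; D \<in> T; f \<in> hom C A B; g \<in> hom C B D; x \<in> fob F D\<rbrakk>
    \<Longrightarrow> fmor F A D (g \<cdot>\<^bsub>C\<^esub> f) x = fmor F A B f (fmor F B D g x)"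
  unfolding additive_functor_def by blast

lemma nat_transf_zero:
  assumes "additive_functor C T F" "nat_transf C T F G \<eta>" "A \<in> T"
  shows "\<eta> A 0 = (0 :: 'm :: ab_group_add)"
  using nat_transf_add[OF assms(2,3) additive_functor_zero[OF assms(1,3)]
      additive_functor_zero[OF assms(1,3)]] by simp

lemma projective_additive: "projective C T P \<Longrightarrow> additive_functor C T P"
  by (simp add: projective_def finitely_presented_def)

lemma projective_lift:
  assumes "projective C T P" "finitely_presented C T M" "finitely_presented C T N"
    "nat_transf C T M N \<epsilon>" "pointwise_surj T M N \<epsilon>" "nat_transf C T P N \<phi>"
  obtains \<psi> where "nat_transf C T P M \<psi>" "\<And>A x. \<lbrakk>A \<in> T; x \<in> fob P A\<rbrakk> \<Longrightarrow> \<epsilon> A (\<psi> A x) = \<phi> A x"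
  using assms unfolding projective_def by blast

section \<open>Representable functors, their images and resolutions by objects of T\<close>

lemma fob_H [simp]: "fob (H_functor C X) A = hom C A X"
  and fmor_H [simp]: "fmor (H_functor C X) A B f x = x \<cdot>\<^bsub>C\<^esub> f"
  by (simp_all add: H_functor_def)

text \<open>For \<open>d\<close> in Hom(A, B) this is the image of H A -> H B as a subfunctor of H
  B; it serves as a finitely presented target in lifting problems.\<close>

definition image_functor ::
    "('o, 'm, 'k, 'z) lin_cat_scheme \<Rightarrow> 'o \<Rightarrow> 'm \<Rightarrow> ('o, 'm) contra_functor" where
  "image_functor C A d = \<lparr>fob = (\<lambda>S. (\<lambda>x. d \<cdot>\<^bsub>C\<^esub> x) ` hom C S A), fmor = (\<lambda>S R f g. g \<cdot>\<^bsub>C\<^esub> f)\<rparr>"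

lemma fob_image [simp]: "fob (image_functor C A d) S = (\<lambda>x. d \<cdot>\<^bsub>C\<^esub> x) ` hom C S A"
  and fmor_image [simp]: "fmor (image_functor C A d) S R f g = g \<cdot>\<^bsub>C\<^esub> f"
  by (simp_all add: image_functor_def)

text \<open>H turns such a sequence into a projective resolution of H(Q 0), with D 0 as augmentation; Q 0
  itself need not lie in T.\<close>

definition T_resolution ::
    "('o, 'm::ab_group_add, 'k, 'z) lin_cat_scheme \<Rightarrow> 'o set \<Rightarrow> (nat \<Rightarrow> 'o) \<Rightarrow> (nat \<Rightarrow> 'm) \<Rightarrow> bool" where
  "T_resolution C T Q D \<longleftrightarrow>
     (\<forall>n. Q (Suc n) \<in> T \<and> D n \<in> hom C (Q (Suc n)) (Q n) \<and> D n \<cdot>\<^bsub>C\<^esub> D (Suc n) = 0 \<and>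
        (\<forall>S \<in> T. \<forall>y \<in> hom C S (Q (Suc n)). D n \<cdot>\<^bsub>C\<^esub> y = 0 \<longrightarrow>
           (\<exists>z \<in> hom C S (Q (Suc (Suc n))). y = D (Suc n) \<cdot>\<^bsub>C\<^esub> z))) \<and>
     (\<forall>S \<in> T. \<forall>y \<in> hom C S (Q 0). \<exists>z \<in> hom C S (Q 1). y = D 0 \<cdot>\<^bsub>C\<^esub> z)"

context linear_category
begin

lemma image_functor_idt: "image_functor C A (idt C A) = H_functor C A"
proof -
  have "(\<lambda>x. idt C A \<cdot> x) ` hom C S A = hom C S A" for S by force
  then show ?thesis by (simp add: image_functor_def H_functor_def)
qed

lemma nat_transf_cmp:
  assumes d: "d \<in> hom C A B"
  shows "nat_transf C T (H_functor C A) (H_functor C B) (\<lambda>S x. d \<cdot> x)"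
  unfolding nat_transf_def using d
  by (auto simp: cmp_in_hom[OF _ d] cmp_add_right[OF _ _ d] cmp_assoc[OF _ _ d])

lemma nat_transf_image:
  assumes d: "d \<in> hom C A B"
  shows "nat_transf C T (H_functor C A) (image_functor C A d) (\<lambda>S x. d \<cdot> x)"
  unfolding nat_transf_def
  by (auto simp: cmp_add_right[OF _ _ d] cmp_assoc[OF _ _ d])

lemma additive_functor_image:
  assumes d: "d \<in> hom C A B"
  shows "additive_functor C T (image_functor C A d)"
proof -
  have "0 \<in> (\<lambda>x. d \<cdot> x) ` hom C S A" for S
    using cmp_zero_right[OF d] by (intro image_eqI[of _ _ 0]) auto
  moreover have "x - y \<in> (\<lambda>x. d \<cdot> x) ` hom C S A"
    if "x \<in> (\<lambda>x. d \<cdot> x) ` hom C S A" "y \<in> (\<lambda>x. d \<cdot> x) ` hom C S A" for x y S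
    using that cmp_diff_right[OF _ _ d, symmetric] by auto
  moreover have "d \<cdot> x \<cdot> f \<in> (\<lambda>x. d \<cdot> x) ` hom C S A"
    if f: "f \<in> hom C S R" and x: "x \<in> hom C R A" for f x S R
    using cmp_assoc[OF f x d] cmp_in_hom[OF f x] by auto
  moreover have "(d \<cdot> x + d \<cdot> y) \<cdot> f = d \<cdot> x \<cdot> f + d \<cdot> y \<cdot> f"
    if "f \<in> hom C S R" "x \<in> hom C R A" "y \<in> hom C R A" for f x y S R
    using cmp_add_left[OF that(1) cmp_in_hom[OF that(2) d] cmp_in_hom[OF that(3) d]] .
  moreover have "d \<cdot> x \<cdot> (f + g) = d \<cdot> x \<cdot> f + d \<cdot> x \<cdot> g"
    if "f \<in> hom C S R" "g \<in> hom C S R" "x \<in> hom C R A" for f g x S R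
    using cmp_add_right[OF that(1,2) cmp_in_hom[OF that(3) d]] .
  moreover have "d \<cdot> x \<cdot> idt C S = d \<cdot> x" if "x \<in> hom C S A" for x S
    using idt_right[OF cmp_in_hom[OF that d]] .
  moreover have "d \<cdot> x \<cdot> (g \<cdot> f) = d \<cdot> x \<cdot> g \<cdot> f"
    if "f \<in> hom C S R" "g \<in> hom C R Q" "x \<in> hom C Q A" for f g x S R Q
    using cmp_assoc[OF that(1,2) cmp_in_hom[OF that(3) d]] by simp
  ultimately show ?thesis unfolding additive_functor_def by auto
qed

text \<open>The weak kernel \<open>k\<close> supplies the relations.\<close>

lemma finitely_presented_image:
  assumes T: "K \<in> T" "A \<in> T" and k: "k \<in> hom C K A" and d: "d \<in> hom C A B" and dk: "d \<cdot> k = 0"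
    and ex: "\<And>S y. \<lbrakk>S \<in> T; y \<in> hom C S A; d \<cdot> y = 0\<rbrakk> \<Longrightarrow> \<exists>z \<in> hom C S K. y = k \<cdot> z"
  shows "finitely_presented C T (image_functor C A d)"
proof -
  have "d \<cdot> (k \<cdot> z) = 0" if "z \<in> hom C S K" for z S
    using cmp_assoc[OF that k d] dk cmp_zero_left[OF that] by simp
  then have "pointwise_exact T (H_functor C K) (H_functor C A) (\<lambda>S x. k \<cdot> x) (\<lambda>S x. d \<cdot> x)"
    unfolding pointwise_exact_def using ex cmp_in_hom[OF _ k] by fastforce
  moreover have "pointwise_surj T (H_functor C A) (image_functor C A d) (\<lambda>S x. d \<cdot> x)"
    by (simp add: pointwise_surj_def)
  ultimately show ?thesis
    unfolding finitely_presented_def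
    using additive_functor_image[OF d] T nat_transf_cmp[OF k] nat_transf_image[OF d] by blast
qed

text \<open>\<open>H_functor C A\<close> is the image functor of the identity, with the zero map as
  relations.\<close>

lemma finitely_presented_H:
  assumes A: "A \<in> T"
  shows "finitely_presented C T (H_functor C A)"
proof -
  have "finitely_presented C T (image_functor C A (idt C A))"
  proof (rule finitely_presented_image[OF A A hom_zero idt_in_hom])
    show "idt C A \<cdot> 0 = 0" by (simp add: cmp_zero_right[of _ A A])
    fix S y assume "y \<in> hom C S A" "idt C A \<cdot> y = 0"
    then have "y = 0 \<cdot> 0" by (simp add: cmp_zero_left[of 0 S A])
    then show "\<exists>z \<in> hom C S A. y = 0 \<cdot> z" using hom_zero by blast
  qed
  then show ?thesis by (simp add: image_functor_idt)
qed

text \<open>By the Yoneda lemma a transformation out of \<open>H_functor C A\<close> is determined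
  by its value at \<open>idt C A\<close>, so it suffices to lift this one element.\<close>

lemma projective_H:
  assumes A: "A \<in> T"
  shows "projective C T (H_functor C A)"
  unfolding projective_def
proof (intro conjI allI impI finitely_presented_H[OF A])
  fix M N \<epsilon> \<phi>
  assume "finitely_presented C T M \<and> finitely_presented C T N \<and> nat_transf C T M N \<epsilon> \<and>
    pointwise_surj T M N \<epsilon> \<and> nat_transf C T (H_functor C A) N \<phi>"
  then have M: "additive_functor C T M" and \<epsilon>: "nat_transf C T M N \<epsilon>"
    and surj: "pointwise_surj T M N \<epsilon>" and \<phi>: "nat_transf C T (H_functor C A) N \<phi>"
    by (auto simp: finitely_presented_def)
  have "\<phi> A (idt C A) \<in> fob N A" using nat_transf_in[OF \<phi> A] by simp
  then have "\<phi> A (idt C A) \<in> \<epsilon> A ` fob M A" using surj A by (simp add: pointwise_surj_def)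
  then obtain m where m: "m \<in> fob M A" "\<epsilon> A m = \<phi> A (idt C A)" by force
  have "nat_transf C T (H_functor C A) M (\<lambda>S x. fmor M S A x m)"
    unfolding nat_transf_def
    using fmor_in[OF M _ A _ m(1)] fmor_add_left[OF M _ A _ _ m(1)] fmor_cmp[OF M _ _ A _ _ m(1)]
    by simp
  moreover have "\<epsilon> S (fmor M S A x m) = \<phi> S x" if S: "S \<in> T" and x: "x \<in> hom C S A" for S x
    using nat_transf_natural[OF \<epsilon> S A x m(1)] nat_transf_natural[OF \<phi> S A x, of "idt C A"] m(2) x
    by simp
  ultimately show "\<exists>\<psi>. nat_transf C T (H_functor C A) M \<psi> \<and>
      (\<forall>S \<in> T. \<forall>x \<in> fob (H_functor C A) S. \<epsilon> S (\<psi> S x) = \<phi> S x)"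
    by (intro exI[of _ "\<lambda>S x. fmor M S A x m"]) simp
qed

text \<open>By \<open>fac\<close>, \<open>\<eta>\<close> lands in the image functor of
  \<open>D n\<close>, which is finitely presented with relations from \<open>D (Suc n)\<close>;
  projectivity lifts it from there.\<close>

lemma T_resolution_lift:
  assumes Q: "T_resolution C T Q D" and P: "projective C T P"
    and \<eta>: "nat_transf C T P (H_functor C (Q n)) \<eta>"
    and fac: "\<And>S x. \<lbrakk>S \<in> T; x \<in> fob P S\<rbrakk> \<Longrightarrow> \<exists>z \<in> hom C S (Q (Suc n)). \<eta> S x = D n \<cdot> z"
  obtains \<psi> where "nat_transf C T P (H_functor C (Q (Suc n))) \<psi>"
    "\<And>S x. \<lbrakk>S \<in> T; x \<in> fob P S\<rbrakk> \<Longrightarrow> D n \<cdot> \<psi> S x = \<eta> S x"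
proof -
  have T: "Q (Suc n) \<in> T" "Q (Suc (Suc n)) \<in> T" and d: "D n \<in> hom C (Q (Suc n)) (Q n)"
    and d': "D (Suc n) \<in> hom C (Q (Suc (Suc n))) (Q (Suc n))" and dd: "D n \<cdot> D (Suc n) = 0"
    and ex: "\<And>S y. \<lbrakk>S \<in> T; y \<in> hom C S (Q (Suc n)); D n \<cdot> y = 0\<rbrakk>
      \<Longrightarrow> \<exists>z \<in> hom C S (Q (Suc (Suc n))). y = D (Suc n) \<cdot> z"
    using Q unfolding T_resolution_def by blast+
  let ?N = "image_functor C (Q (Suc n)) (D n)"
  have N: "finitely_presented C T ?N"
    using finitely_presented_image[OF T(2,1) d' d dd ex] .
  have "nat_transf C T P ?N \<eta>"
    using \<eta> fac unfolding nat_transf_def by (simp add: image_iff)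
  moreover have "pointwise_surj T (H_functor C (Q (Suc n))) ?N (\<lambda>S x. D n \<cdot> x)"
    by (simp add: pointwise_surj_def)
  ultimately show thesis
    using projective_lift[OF P finitely_presented_H[OF T(1)] N nat_transf_image[OF d]] that by blast
qed

text \<open>The comparison theorem: composing the comparison maps H(Q) \<open>\<rightarrow>\<close> P \<open>\<rightarrow>\<close> H(Q) yields a chain
  endomorphism that lifts the identity of H(X) and vanishes in degree n + 1, and \<open>s\<close> is the
  component in degree n of a null homotopy of its difference to the identity. By the Yoneda lemma the
  maps H(Q) \<open>\<rightarrow>\<close> P are given by elements \<open>\<theta>\<close>.\<close>

lemma resolution_splitting:
  assumes Q: "T_resolution C T Q D"
    and res: "projective_resolution C T (H_functor C (Q 0)) n P d"
  shows "\<exists>s \<in> hom C (Q (Suc n)) (Q (Suc (Suc n))). D (Suc n) \<cdot> (s \<cdot> D (Suc n)) = D (Suc n)"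
proof -
  have T: "Q (Suc k) \<in> T" and D: "D k \<in> hom C (Q (Suc k)) (Q k)" and DD: "D k \<cdot> D (Suc k) = 0"
    and ex: "\<And>S y. \<lbrakk>S \<in> T; y \<in> hom C S (Q (Suc k)); D k \<cdot> y = 0\<rbrakk>
      \<Longrightarrow> \<exists>z \<in> hom C S (Q (Suc (Suc k))). y = D (Suc k) \<cdot> z"
    and ex0: "\<And>S y. \<lbrakk>S \<in> T; y \<in> hom C S (Q 0)\<rbrakk> \<Longrightarrow> \<exists>z \<in> hom C S (Q 1). y = D 0 \<cdot> z" for k
    using Q unfolding T_resolution_def by blast+
  have P: "projective C T (P k)" if "k \<le> n" for k
    using res that by (auto simp: projective_resolution_def)
  note add = projective_additive[OF P]
  have d0: "nat_transf C T (P 0) (H_functor C (Q 0)) (d 0)"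
    and surj: "pointwise_surj T (P 0) (H_functor C (Q 0)) (d 0)"
    and inj: "pointwise_inj T (P n) (d n)"
    using res by (auto simp: projective_resolution_def)
  have dS: "nat_transf C T (P (Suc k)) (P k) (d (Suc k))"
    and exP: "pointwise_exact T (P (Suc k)) (P k) (d (Suc k)) (d k)" if "k < n" for k
    using res that by (auto simp: projective_resolution_def)
  \<comment> \<open>Degree \<open>k\<close> belongs to \<open>Q (Suc k)\<close> because
    \<open>Q 0\<close> is the augmented object. \<open>\<theta>\<close> represents the map H(Q (Suc
    k)) -> P k, \<open>\<psi>\<close> is the map back, and \<open>s\<close> is the homotopy.
    Composing the homotopy relation with \<open>D (Suc k)\<close> removes its term from the previous
    degree; the clauses on \<open>d k\<close> let both comparison maps continue to the next
    degree.\<close>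
  let ?R = "\<lambda>k \<theta> \<psi> s. \<theta> \<in> fob (P k) (Q (Suc k)) \<and> s \<in> hom C (Q (Suc k)) (Q (Suc (Suc k))) \<and>
     nat_transf C T (P k) (H_functor C (Q (Suc k))) \<psi> \<and>
     d k (Q (Suc (Suc k))) (fmor (P k) (Q (Suc (Suc k))) (Q (Suc k)) (D (Suc k)) \<theta>) = 0 \<and>
     (\<forall>S \<in> T. \<forall>x \<in> fob (P k) S. d k S x = 0 \<longrightarrow> D k \<cdot> \<psi> S x = 0) \<and>
     (idt C (Q (Suc k)) - \<psi> (Q (Suc k)) \<theta> - D (Suc k) \<cdot> s) \<cdot> D (Suc k) = 0"
  have "\<exists>\<theta> \<psi> s. ?R k \<theta> \<psi> s" if "k \<le> n" for k
    using that
  proof (induction k)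
    case 0
    let ?A = "Q (Suc 0)"
    have "D 0 \<in> d 0 ?A ` fob (P 0) ?A" using surj T[of 0] D[of 0] by (simp add: pointwise_surj_def)
    then obtain \<theta> where \<theta>: "\<theta> \<in> fob (P 0) ?A" "d 0 ?A \<theta> = D 0" by force
    obtain \<psi> where \<psi>: "nat_transf C T (P 0) (H_functor C ?A) \<psi>"
      "\<And>S x. \<lbrakk>S \<in> T; x \<in> fob (P 0) S\<rbrakk> \<Longrightarrow> D 0 \<cdot> \<psi> S x = d 0 S x"
      using T_resolution_lift[OF Q P[OF 0] d0] ex0 nat_transf_in[OF d0] by auto
    have \<phi>: "\<psi> ?A \<theta> \<in> hom C ?A ?A" using nat_transf_in[OF \<psi>(1) T \<theta>(1)] by simp
    have "D 0 \<cdot> (idt C ?A - \<psi> ?A \<theta>) = 0"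
      using cmp_diff_right[OF idt_in_hom \<phi> D] \<psi>(2)[OF T \<theta>(1)] \<theta>(2) idt_right[OF D] by simp
    then obtain s where s: "s \<in> hom C ?A (Q (Suc (Suc 0)))" "idt C ?A - \<psi> ?A \<theta> = D (Suc 0) \<cdot> s"
      using ex[OF T hom_diff[OF idt_in_hom \<phi>]] by blast
    have "d 0 (Q (Suc (Suc 0))) (fmor (P 0) (Q (Suc (Suc 0))) ?A (D (Suc 0)) \<theta>) = 0"
      using nat_transf_natural[OF d0 T T D \<theta>(1)] \<theta>(2) DD[of 0] by simp
    then have "?R 0 \<theta> \<psi> s" using \<theta> s \<psi> cmp_zero_left[OF D[of "Suc 0"]] by simp
    then show ?case by blast
  next
    case (Suc k)
    then have k: "k < n" "k \<le> n" by auto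
    from Suc obtain \<theta> \<psi> s where R: "?R k \<theta> \<psi> s" by auto
    let ?A = "Q (Suc k)" and ?B = "Q (Suc (Suc k))" and ?E = "Q (Suc (Suc (Suc k)))"
    let ?D = "D (Suc k)"
    from R have \<theta>: "\<theta> \<in> fob (P k) ?A" and s: "s \<in> hom C ?A ?B"
      and \<psi>: "nat_transf C T (P k) (H_functor C ?A) \<psi>"
      and d\<theta>: "d k ?B (fmor (P k) ?B ?A ?D \<theta>) = 0"
      and D\<psi>: "\<And>S x. \<lbrakk>S \<in> T; x \<in> fob (P k) S; d k S x = 0\<rbrakk> \<Longrightarrow> D k \<cdot> \<psi> S x = 0"
      and htpy: "(idt C ?A - \<psi> ?A \<theta> - ?D \<cdot> s) \<cdot> ?D = 0" by blast+
    note dk = dS[OF k(1)]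
    have "fmor (P k) ?B ?A ?D \<theta> \<in> d (Suc k) ?B ` fob (P (Suc k)) ?B"
      using exP[OF k(1)] T d\<theta> fmor_in[OF add[OF k(2)] T T D \<theta>] by (simp add: pointwise_exact_def)
    then obtain \<theta>' where \<theta>': "\<theta>' \<in> fob (P (Suc k)) ?B" "d (Suc k) ?B \<theta>' = fmor (P k) ?B ?A ?D \<theta>"
      by force
    have ddx: "d k S (d (Suc k) S x) = 0" if "S \<in> T" "x \<in> fob (P (Suc k)) S" for S x
      using exP[OF k(1)] that unfolding pointwise_exact_def by blast
    let ?\<eta> = "\<lambda>S x. \<psi> S (d (Suc k) S x)"
    have \<eta>: "nat_transf C T (P (Suc k)) (H_functor C ?A) ?\<eta>"
      using nat_transf_comp[OF dk \<psi>] .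
    have "\<exists>z \<in> hom C S ?B. ?\<eta> S x = ?D \<cdot> z" if S: "S \<in> T" and x: "x \<in> fob (P (Suc k)) S" for S x
      using ex[OF S, of "?\<eta> S x"] nat_transf_in[OF \<eta> S x]
        D\<psi>[OF S nat_transf_in[OF dk S x] ddx[OF S x]] by simp
    then obtain \<psi>' where \<psi>': "nat_transf C T (P (Suc k)) (H_functor C ?B) \<psi>'"
      "\<And>S x. \<lbrakk>S \<in> T; x \<in> fob (P (Suc k)) S\<rbrakk> \<Longrightarrow> ?D \<cdot> \<psi>' S x = ?\<eta> S x"
      using T_resolution_lift[OF Q P[OF Suc.prems] \<eta>] by blast
    have \<phi>: "\<psi> ?A \<theta> \<in> hom C ?A ?A" using nat_transf_in[OF \<psi> T \<theta>] by simp
    have \<phi>': "\<psi>' ?B \<theta>' \<in> hom C ?B ?B" using nat_transf_in[OF \<psi>'(1) T \<theta>'(1)] by simp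
    have sD: "s \<cdot> ?D \<in> hom C ?B ?B" using D s by (rule cmp_in_hom)
    have Ds: "?D \<cdot> s \<in> hom C ?A ?A" using s D by (rule cmp_in_hom)
    \<comment> \<open>By the relation in degree \<open>k\<close>, \<open>?u\<close> is annihilated
      by \<open>?D\<close>; factoring it through the next differential gives the new homotopy
      component.\<close>
    let ?u = "idt C ?B - \<psi>' ?B \<theta>' - s \<cdot> ?D"
    have u: "?u \<in> hom C ?B ?B" using \<phi>' sD by simp
    have "?D \<cdot> \<psi>' ?B \<theta>' = \<psi> ?A \<theta> \<cdot> ?D"
      using \<psi>'(2)[OF T \<theta>'(1)] \<theta>'(2) nat_transf_natural[OF \<psi> T T D \<theta>] by simp
    then have "?D \<cdot> ?u = ?D - \<psi> ?A \<theta> \<cdot> ?D - ?D \<cdot> s \<cdot> ?D"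
      using cmp_diff_right[OF hom_diff[OF idt_in_hom \<phi>'] sD D] cmp_diff_right[OF idt_in_hom \<phi>' D]
        idt_right[OF D] cmp_assoc[OF D s D] by simp
    also have "\<dots> = (idt C ?A - \<psi> ?A \<theta> - ?D \<cdot> s) \<cdot> ?D"
      using cmp_diff_left[OF D hom_diff[OF idt_in_hom \<phi>] Ds] cmp_diff_left[OF D idt_in_hom \<phi>]
        idt_left[OF D] by simp
    finally have "?D \<cdot> ?u = 0" using htpy by simp
    then obtain s' where s': "s' \<in> hom C ?B ?E" "?u = D (Suc (Suc k)) \<cdot> s'"
      using ex[OF T u] by blast
    let ?D' = "D (Suc (Suc k))"
    have "idt C ?B - \<psi>' ?B \<theta>' - ?D' \<cdot> s' = s \<cdot> ?D" using s'(2) by (simp add: algebra_simps)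
    then have h': "(idt C ?B - \<psi>' ?B \<theta>' - ?D' \<cdot> s') \<cdot> ?D' = 0"
      using cmp_assoc[OF D D s] DD[of "Suc k"] cmp_zero_right[OF s] by simp
    have "d (Suc k) ?E (fmor (P (Suc k)) ?E ?B ?D' \<theta>') = fmor (P k) ?E ?A (?D \<cdot> ?D') \<theta>"
      using nat_transf_natural[OF dk T T D \<theta>'(1)] \<theta>'(2) fmor_cmp[OF add[OF k(2)] T T T D D \<theta>] by simp
    also have "\<dots> = 0"
      using DD[of "Suc k"] fmor_add_left[OF add[OF k(2)] T T hom_zero hom_zero \<theta>] by simp
    finally have d\<theta>': "d (Suc k) ?E (fmor (P (Suc k)) ?E ?B ?D' \<theta>') = 0" .
    have "?D \<cdot> \<psi>' S x = 0" if S: "S \<in> T" and x: "x \<in> fob (P (Suc k)) S" "d (Suc k) S x = 0" for S x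
      using \<psi>'(2)[OF S x(1)] x(2) nat_transf_zero[OF add[OF k(2)] \<psi> S] by simp
    then have "?R (Suc k) \<theta>' \<psi>' s'" using \<theta>'(1) s'(1) \<psi>'(1) d\<theta>' h' by blast
    then show ?case by blast
  qed
  then obtain \<theta> \<psi> s where R: "?R n \<theta> \<psi> s" by blast
  let ?A = "Q (Suc n)" and ?B = "Q (Suc (Suc n))"
  let ?D = "D (Suc n)"
  from R have \<theta>: "\<theta> \<in> fob (P n) ?A" and s: "s \<in> hom C ?A ?B"
    and \<psi>: "nat_transf C T (P n) (H_functor C ?A) \<psi>"
    and d\<theta>: "d n ?B (fmor (P n) ?B ?A ?D \<theta>) = 0"
    and htpy: "(idt C ?A - \<psi> ?A \<theta> - ?D \<cdot> s) \<cdot> ?D = 0" by blast+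
  note an = add[OF order_refl]
  have \<theta>D: "fmor (P n) ?B ?A ?D \<theta> \<in> fob (P n) ?B" using fmor_in[OF an T T D \<theta>] .
  \<comment> \<open>The augmentation \<open>d 0\<close> and the differentials have different
    targets, hence the case distinction.\<close>
  have "d n ?B 0 = 0"
  proof (cases n)
    case 0
    then show ?thesis using nat_transf_zero[OF add[OF le0] d0 T[of "Suc n"]] by simp
  next
    case (Suc k)
    then show ?thesis using nat_transf_zero[OF an[unfolded Suc] dS[of k] T[of "Suc n"]] by simp
  qed
  \<comment> \<open>Injectivity of \<open>d n\<close> makes the comparison endomorphism vanish after
    \<open>?D\<close>, and the homotopy relation becomes the splitting equation.\<close>
  then have "fmor (P n) ?B ?A ?D \<theta> = 0"
    using inj d\<theta> \<theta>D additive_functor_zero[OF an T] T unfolding pointwise_inj_def inj_on_def by metis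
  then have \<phi>D: "\<psi> ?A \<theta> \<cdot> ?D = 0"
    using nat_transf_natural[OF \<psi> T T D \<theta>] nat_transf_zero[OF an \<psi> T] by simp
  have \<phi>: "\<psi> ?A \<theta> \<in> hom C ?A ?A" using nat_transf_in[OF \<psi> T \<theta>] by simp
  have "(idt C ?A - \<psi> ?A \<theta> - ?D \<cdot> s) \<cdot> ?D = ?D - ?D \<cdot> (s \<cdot> ?D)"
    using cmp_diff_left[OF D hom_diff[OF idt_in_hom \<phi>] cmp_in_hom[OF s D]]
      cmp_diff_left[OF D idt_in_hom \<phi>] \<phi>D idt_left[OF D] cmp_assoc[OF D s D] by simp
  then have "?D \<cdot> (s \<cdot> ?D) = ?D" using htpy by simp
  with s show ?thesis by blast
qed

end

text \<open>Weak kernels are chosen one after another by dependent choice, continuing the prescribed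
  maps \<open>f\<close> and \<open>d\<close>.\<close>

lemma (in linear_category) T_resolution_exists:
  assumes T: "A \<in> T" "B \<in> T" and d: "d \<in> hom C A B" and f: "f \<in> hom C B X" and fd: "f \<cdot> d = 0"
    and surj: "\<And>S y. \<lbrakk>S \<in> T; y \<in> hom C S X\<rbrakk> \<Longrightarrow> \<exists>z \<in> hom C S B. y = f \<cdot> z"
    and ex: "\<And>S y. \<lbrakk>S \<in> T; y \<in> hom C S B; f \<cdot> y = 0\<rbrakk> \<Longrightarrow> \<exists>z \<in> hom C S A. y = d \<cdot> z"
    and ker: "\<And>A B d. \<lbrakk>A \<in> T; d \<in> hom C A B\<rbrakk> \<Longrightarrow> \<exists>K \<in> T. \<exists>k \<in> hom C K A. d \<cdot> k = 0 \<and>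
      (\<forall>S \<in> T. \<forall>y \<in> hom C S A. d \<cdot> y = 0 \<longrightarrow> (\<exists>z \<in> hom C S K. y = k \<cdot> z))"
  obtains Q D where "T_resolution C T Q D" "Q 0 = X" "Q 1 = B" "Q 2 = A" "D 0 = f" "D 1 = d"
proof -
  \<comment> \<open>A state is a triple of source, target and map. \<open>ok\<close> forces the
    states 0 and 1 to be \<open>f\<close> and \<open>d\<close>; \<open>step\<close> makes the next
    map a weak kernel on \<open>T\<close> that ends at the current source.\<close>
  define ok where "ok = (\<lambda>n x. case x of (A', B', d') \<Rightarrow> A' \<in> T \<and> d' \<in> hom C A' B' \<and>
    (n = 0 \<longrightarrow> x = (B, X, f)) \<and> (n = Suc 0 \<longrightarrow> x = (A, B, d)))"
  define step where "step = (\<lambda>(x :: 'o \<times> 'o \<times> 'm) (y :: 'o \<times> 'o \<times> 'm). case x of (A', B', d') \<Rightarrow> case y of (K, A'', k) \<Rightarrow> A'' = A' \<and>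
    d' \<cdot> k = 0 \<and> (\<forall>S \<in> T. \<forall>y \<in> hom C S A'. d' \<cdot> y = 0 \<longrightarrow> (\<exists>z \<in> hom C S K. y = k \<cdot> z)))"
  have next_step: "\<exists>y. ok (Suc n) y \<and> step x y" if "ok n x" for n :: nat and x
  proof (cases n)
    case 0
    then have "ok (Suc n) (A, B, d) \<and> step x (A, B, d)"
      using that T d fd ex by (auto simp: ok_def step_def)
    then show ?thesis by blast
  next
    case (Suc m)
    obtain A' B' d' where x: "x = (A', B', d')" by (cases x)
    have "A' \<in> T" "d' \<in> hom C A' B'" using that by (auto simp: x ok_def)
    then obtain K k where "K \<in> T" "k \<in> hom C K A'" "d' \<cdot> k = 0"
      "\<forall>S \<in> T. \<forall>y \<in> hom C S A'. d' \<cdot> y = 0 \<longrightarrow> (\<exists>z \<in> hom C S K. y = k \<cdot> z)"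
      using ker by blast
    then have "ok (Suc n) (K, A', k) \<and> step x (K, A', k)" using x Suc by (auto simp: ok_def step_def)
    then show ?thesis by blast
  qed
  have "ok 0 (B, X, f)" using T f by (simp add: ok_def)
  then have "\<exists>st. \<forall>n. ok n (st n) \<and> step (st n) (st (Suc n))"
    using dependent_nat_choice[of ok "\<lambda>_. step"] next_step by metis
  then obtain st where st: "ok n (st n)" "step (st n) (st (Suc n))" for n :: nat by blast
  define Q where "Q n = fst (snd (st n))" for n
  define D where "D n = snd (snd (st n))" for n
  have Q_Suc: "fst (st n) = Q (Suc n)" for n
    using st(2)[of n] by (auto simp: Q_def step_def split: prod.splits)
  have st_eq: "st n = (Q (Suc n), Q n, D n)" for n
    by (metis Q_Suc Q_def D_def prod.collapse)
  have 0: "st 0 = (B, X, f)" and 1: "st 1 = (A, B, d)"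
    using st(1)[of 0] st(1)[of 1] by (auto simp: ok_def split: prod.splits)
  have Q0: "Q 0 = X" "Q 1 = B" "Q 2 = A" "D 0 = f" "D 1 = d"
    using 0 1 st_eq[of 0] st_eq[of 1] by (simp_all add: numeral_2_eq_2)
  have "T_resolution C T Q D"
    unfolding T_resolution_def
    using st[unfolded st_eq ok_def step_def] surj Q0 by simp
  then show thesis using that Q0 by blast
qed

section \<open>Finite projective dimension and vanishing of the factor ideal\<close>

context cluster_tilting_subcategory
begin

text \<open>The approximation triangle itself becomes a projective resolution with two terms, since
  H A -> H B is mono.\<close>

lemma pd_finite_if_factor_ideal_zero:
  assumes "\<not> factor_ideal_nonzero C (shift_subcategory C T) X"
  shows "\<exists>P d. projective_resolution C T (H_functor C X) 1 P d"
proof -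
  obtain A B d f h where A: "A \<in> T" and B: "B \<in> T" and t: "tri C A B X d f h"
    and app: "right_approximation C T X B f"
    using approximation_triangle[of X] .
  have d: "d \<in> hom C A B" and f: "f \<in> hom C B X" using tri_in_hom[OF t] by auto
  have mono: "\<forall>S \<in> T. \<forall>m \<in> hom C S A. d \<cdot> m = 0 \<longrightarrow> m = 0"
    using factor_ideal_zero_iff_mono[OF A t app] assms by simp
  define P where "P i = (if i = 0 then H_functor C B else H_functor C A)" for i :: nat
  define \<delta> where "\<delta> i = (\<lambda>(S :: 'o) x. if i = 0 then f \<cdot> x else d \<cdot> x)" for i :: nat
  have surj: "pointwise_surj T (P 0) (H_functor C X) (\<delta> 0)"
    unfolding pointwise_surj_def P_def \<delta>_def
    using app cmp_in_hom[OF _ f] by (fastforce simp: right_approximation_def)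
  have "f \<cdot> (d \<cdot> z) = 0" if "z \<in> hom C S A" for z S
    using cmp_assoc[OF that d f] tri_cmp_zero[OF t] cmp_zero_left[OF that] by simp
  moreover have "y \<in> (\<lambda>x. d \<cdot> x) ` hom C S A" if "y \<in> hom C S B" "f \<cdot> y = 0" for y S
    using tri_weak_kernel[OF t that] by blast
  ultimately have ex: "pointwise_exact T (P 1) (P 0) (\<delta> 1) (\<delta> 0)"
    unfolding pointwise_exact_def P_def \<delta>_def using cmp_in_hom[OF _ d] by auto
  have "x = y" if "S \<in> T" "x \<in> hom C S A" "y \<in> hom C S A" "d \<cdot> x = d \<cdot> y" for S x y
    using mono that cmp_diff_right[OF that(2,3) d] hom_diff[OF that(2,3)] by fastforce
  then have "pointwise_inj T (P 1) (\<delta> 1)"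
    unfolding pointwise_inj_def inj_on_def P_def \<delta>_def by simp
  with surj ex have "projective_resolution C T (H_functor C X) 1 P \<delta>"
    unfolding projective_resolution_def
    using projective_H[OF A] projective_H[OF B] nat_transf_cmp[OF d] nat_transf_cmp[OF f]
    by (simp add: P_def \<delta>_def)
  then show ?thesis by blast
qed

lemma factor_ideal_zero_if_pd_finite:
  assumes ks: "krull_schmidt C" and red: "no_summands_in C (shift_subcategory C T) X"
    and res: "projective_resolution C T (H_functor C X) n P \<delta>"
  shows "\<not> factor_ideal_nonzero C (shift_subcategory C T) X"
proof -
  obtain A B d f h where A: "A \<in> T" and B: "B \<in> T" and t: "tri C A B X d f h"
    and app: "right_approximation C T X B f"
    using approximation_triangle[of X] .
  have d: "d \<in> hom C A B" and f: "f \<in> hom C B X" and h: "h \<in> hom C X (sh C A)"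
    using tri_in_hom[OF t] by auto
  obtain Q D where Q: "T_resolution C T Q D" and Q0: "Q 0 = X" "Q 1 = B" "Q 2 = A" "D 0 = f" "D 1 = d"
  proof (rule T_resolution_exists[OF A B d f tri_cmp_zero[OF t]])
    fix S y assume "S \<in> T" "y \<in> hom C S X"
    then show "\<exists>z \<in> hom C S B. y = f \<cdot> z" using app unfolding right_approximation_def by blast
  next
    fix S y assume "S \<in> T" "y \<in> hom C S B" "f \<cdot> y = 0"
    then show "\<exists>z \<in> hom C S A. y = d \<cdot> z" using tri_weak_kernel[OF t] by metis
  next
    fix A' B' d' assume "A' \<in> T" "d' \<in> hom C A' B'"
    then show "\<exists>K \<in> T. \<exists>k \<in> hom C K A'. d' \<cdot> k = 0 \<and>
      (\<forall>S \<in> T. \<forall>y \<in> hom C S A'. d' \<cdot> y = 0 \<longrightarrow> (\<exists>z \<in> hom C S K. y = k \<cdot> z))"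
      using weak_T_kernel[of d' A' B'] by metis
  qed
  have T: "Q (Suc k) \<in> T" and D: "D k \<in> hom C (Q (Suc k)) (Q k)" and DD: "D k \<cdot> D (Suc k) = 0"
    and ex: "\<And>S y. \<lbrakk>S \<in> T; y \<in> hom C S (Q (Suc k)); D k \<cdot> y = 0\<rbrakk>
      \<Longrightarrow> \<exists>z \<in> hom C S (Q (Suc (Suc k))). y = D (Suc k) \<cdot> z" for k
    using Q unfolding T_resolution_def by blast+
  \<comment> \<open>\<open>?split k\<close> says that the map induced by \<open>D k\<close> splits
    onto its image.\<close>
  let ?split = "\<lambda>k. \<exists>s \<in> hom C (Q k) (Q (Suc k)). D k \<cdot> (s \<cdot> D k) = D k"
  \<comment> \<open>For \<open>n = 0\<close> the comparison only splits \<open>D 1\<close>; the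
    complementary idempotent of \<open>A\<close> then factors through \<open>D 2\<close> and splits
    that map.\<close>
  have up: "?split (Suc (Suc 0))" if "?split (Suc 0)"
  proof -
    from that obtain s where s: "s \<in> hom C (Q (Suc 0)) (Q (Suc (Suc 0)))"
      "D (Suc 0) \<cdot> (s \<cdot> D (Suc 0)) = D (Suc 0)" by blast
    let ?A = "Q (Suc (Suc 0))"
    have sD: "s \<cdot> D (Suc 0) \<in> hom C ?A ?A" using D s(1) by (rule cmp_in_hom)
    have "D (Suc 0) \<cdot> (idt C ?A - s \<cdot> D (Suc 0)) = 0"
      using cmp_diff_right[OF idt_in_hom sD D] s(2) idt_right[OF D] by simp
    then obtain s' where s': "s' \<in> hom C ?A (Q (Suc (Suc (Suc 0))))"
      "idt C ?A - s \<cdot> D (Suc 0) = D (Suc (Suc 0)) \<cdot> s'"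
      using ex[OF T hom_diff[OF idt_in_hom sD]] by blast
    have "D (Suc (Suc 0)) \<cdot> (s' \<cdot> D (Suc (Suc 0))) = (idt C ?A - s \<cdot> D (Suc 0)) \<cdot> D (Suc (Suc 0))"
      using cmp_assoc[OF D s'(1) D] s'(2) by simp
    also have "\<dots> = D (Suc (Suc 0))"
      using cmp_diff_left[OF D idt_in_hom sD] cmp_assoc[OF D D s(1)] DD cmp_zero_right[OF s(1)]
        idt_left[OF D] by simp
    finally show ?thesis using s'(1) by blast
  qed
  \<comment> \<open>The descent stops at \<open>D 2\<close>: one step further
    \<open>Q 0 = X\<close>, which need not lie in \<open>T\<close>, would take the place of
    \<open>G\<close> in \<open>splitting_descends\<close>.\<close>
  have down: "?split (Suc (Suc k)) \<Longrightarrow> ?split (Suc (Suc 0))" for k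
  proof (induction k)
    case (Suc k)
    then obtain s where s: "s \<in> hom C (Q (Suc (Suc (Suc k)))) (Q (Suc (Suc (Suc (Suc k)))))"
      "D (Suc (Suc (Suc k))) \<cdot> (s \<cdot> D (Suc (Suc (Suc k)))) = D (Suc (Suc (Suc k)))" by blast
    have "?split (Suc (Suc k))"
      using splitting_descends[OF T T T D D D DD DD ex ex s] .
    then show ?case by (rule Suc.IH)
  qed
  have "?split (Suc n)" using resolution_splitting[OF Q] res Q0(1) by simp
  then have "?split (Suc (Suc 0))" using up down by (cases n) blast+
  then obtain s where s: "s \<in> hom C A (Q (Suc (Suc (Suc 0))))" "D 2 \<cdot> (s \<cdot> D 2) = D 2"
    using Q0(3) by (auto simp: numeral_2_eq_2)
  have D2: "D 2 \<in> hom C (Q (Suc (Suc (Suc 0)))) A" and dD2: "d \<cdot> D 2 = 0"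
    using D[of 2] DD[of 1] Q0 by (simp_all add: numeral_2_eq_2)
  have ex2: "\<exists>z \<in> hom C S (Q (Suc (Suc (Suc 0)))). y = D 2 \<cdot> z"
    if "S \<in> T" "y \<in> hom C S A" "d \<cdot> y = 0" for S y
  proof -
    have "y \<in> hom C S (Q (Suc 1))" "D 1 \<cdot> y = 0" using that Q0 by (simp_all add: numeral_2_eq_2)
    from ex[OF that(1) this] show ?thesis by (simp add: numeral_2_eq_2)
  qed
  \<comment> \<open>\<open>e\<close> is the idempotent of \<open>A\<close> that cuts out the kernel
    of H A -> H B.\<close>
  define e where "e = D 2 \<cdot> s"
  have e: "e \<in> hom C A A" unfolding e_def using s(1) D2 by (rule cmp_in_hom)
  have eD: "e \<cdot> D 2 = D 2" using cmp_assoc[OF D2 s(1) D2] s(2) by (simp add: e_def)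
  have ee: "e \<cdot> e = e" using cmp_assoc[OF s(1) D2 e] eD by (simp add: e_def)
  have de: "d \<cdot> e = 0"
    using cmp_assoc[OF s(1) D2 d] dD2 cmp_zero_left[OF s(1)] by (simp add: e_def)
  have "e = 0"
  proof (rule ccontr)
    assume e0: "e \<noteq> 0"
    obtain Ys where loc: "\<forall>Y \<in> set Ys. local_end C Y" and ds: "direct_sum C Ys A"
      using ks unfolding krull_schmidt_def by blast
    obtain i p where ip_all: "\<forall>j < length Ys. i j \<in> hom C (Ys ! j) A"
      "\<forall>j < length Ys. p j \<in> hom C A (Ys ! j)"
      "\<forall>j < length Ys. \<forall>l < length Ys. p j \<cdot> i l = (if j = l then idt C (Ys ! j) else 0)"
      "(\<Sum>j < length Ys. i j \<cdot> p j) = idt C A"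
      using direct_sumE[OF ds] .
    note ip = ip_all(1-3)[rule_format] ip_all(4)
    have locj: "local_end C (Ys ! j)" if "j < length Ys" for j using loc that by simp
    obtain j v where j: "j < length Ys" and v: "v \<in> hom C A (Ys ! j)"
      and iso: "is_iso C (Ys ! j) (Ys ! j) (v \<cdot> (e \<cdot> i j))"
      using idempotent_local_summand[OF locj ip(1,2,4) e ee e0] by blast
    let ?Y = "Ys ! j"
    obtain w where w: "w \<in> hom C ?Y ?Y" and wv: "w \<cdot> (v \<cdot> (e \<cdot> i j)) = idt C ?Y"
      using iso unfolding is_iso_def by blast
    have Y: "?Y \<in> T"
      using T_summand[OF A] retract_direct_summand[OF ip(1,2)[OF j]] ip(3)[OF j j] by simp
    have b: "e \<cdot> i j \<in> hom C ?Y A" using ip(1)[OF j] e by (rule cmp_in_hom)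
    have r: "w \<cdot> v \<in> hom C A ?Y" using v w by (rule cmp_in_hom)
    have rb: "w \<cdot> v \<cdot> (e \<cdot> i j) = idt C ?Y" using wv cmp_assoc[OF b v w] by simp
    \<comment> \<open>Since \<open>d\<close> annihilates \<open>e \<cdot> i j\<close>, the shift of
      this map factors through \<open>h\<close>, which makes Y[1] a retract of
      \<open>X\<close>.\<close>
    have "d \<cdot> (e \<cdot> i j) = 0"
      using cmp_assoc[OF ip(1)[OF j] e d] de cmp_zero_left[OF ip(1)[OF j]] by simp
    then have "(- shm C d) \<cdot> shm C (e \<cdot> i j) = 0"
      using shm_cmp[OF b d] cmp_uminus_left[OF shm_in_hom[OF b] shm_in_hom[OF d]] by simp
    then obtain x where x: "x \<in> hom C (sh C ?Y) X" "shm C (e \<cdot> i j) = h \<cdot> x"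
      using tri_weak_kernel[OF tri_rotate[OF tri_rotate[OF t]] shm_in_hom[OF b]] by blast
    have rh: "shm C (w \<cdot> v) \<cdot> h \<in> hom C X (sh C ?Y)" using h shm_in_hom[OF r] by (rule cmp_in_hom)
    have "shm C (w \<cdot> v) \<cdot> h \<cdot> x = shm C (w \<cdot> v \<cdot> (e \<cdot> i j))"
      using cmp_assoc[OF x(1) h shm_in_hom[OF r]] x(2) shm_cmp[OF b r] by simp
    then have "direct_summand C (sh C ?Y) X"
      using retract_direct_summand[OF x(1) rh] rb by (simp add: shm_idt)
    moreover have "sh C ?Y \<in> shift_subcategory C T"
      using Y is_iso_idt unfolding shift_subcategory_def isomorphic_def by blast
    ultimately have "zero_object C (sh C ?Y)" using red unfolding no_summands_in_def by blast
    then have "idt C ?Y = 0" using shm_eq_0[OF idt_in_hom, of ?Y] by (simp add: zero_object_iff shm_idt)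
    then show False using locj[OF j] by (simp add: local_end_def)
  qed
  \<comment> \<open>Maps annihilated by \<open>d\<close> factor through \<open>D 2\<close>, so they
    are fixed by \<open>e\<close>.\<close>
  then have "m = 0" if S: "S \<in> T" and m: "m \<in> hom C S A" "d \<cdot> m = 0" for S m
    using ex2[OF S m] eD cmp_zero_left[OF D2] by (auto simp: cmp_zero_left)
  then show ?thesis using factor_ideal_zero_iff_mono[OF A t app] by blast
qed

text \<open>Seen from \<open>T\<close>, the maps \<open>u\<close> and \<open>v\<close> are mutually
  inverse, so it suffices to compose the augmentation with \<open>u\<close>.\<close>

lemma projective_resolution_transfer:
  assumes u: "u \<in> hom C X Y" and v: "v \<in> hom C Y X"
    and vu: "\<And>S x. \<lbrakk>S \<in> T; x \<in> hom C S X\<rbrakk> \<Longrightarrow> v \<cdot> (u \<cdot> x) = x"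
    and uv: "\<And>S x. \<lbrakk>S \<in> T; x \<in> hom C S Y\<rbrakk> \<Longrightarrow> u \<cdot> (v \<cdot> x) = x"
    and res: "projective_resolution C T (H_functor C X) n P d"
  shows "projective_resolution C T (H_functor C Y) n P (d(0 := \<lambda>S x. u \<cdot> d 0 S x))"
proof -
  have d0: "nat_transf C T (P 0) (H_functor C X) (d 0)"
    and surj: "pointwise_surj T (P 0) (H_functor C X) (d 0)"
    and inj: "pointwise_inj T (P n) (d n)"
    and ex: "\<And>i. i < n \<Longrightarrow> pointwise_exact T (P (Suc i)) (P i) (d (Suc i)) (d i)"
    using res by (auto simp: projective_resolution_def)
  have dX: "d 0 S x \<in> hom C S X" if "S \<in> T" "x \<in> fob (P 0) S" for S x
    using nat_transf_in[OF d0 that] by simp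
  have u_inj: "u \<cdot> x = u \<cdot> y \<longleftrightarrow> x = y" if "S \<in> T" "x \<in> hom C S X" "y \<in> hom C S X" for S x y
    using vu that by metis
  have u0: "u \<cdot> x = 0 \<longleftrightarrow> x = 0" if "S \<in> T" "x \<in> hom C S X" for S x
    using u_inj[OF that hom_zero] cmp_zero_right[OF u] by simp
  have "pointwise_surj T (P 0) (H_functor C Y) (\<lambda>S x. u \<cdot> d 0 S x)"
    unfolding pointwise_surj_def
  proof
    fix S assume S: "S \<in> T"
    have "d 0 S ` fob (P 0) S = hom C S X" using surj S by (simp add: pointwise_surj_def)
    then have "(\<lambda>x. u \<cdot> d 0 S x) ` fob (P 0) S = (\<lambda>x. u \<cdot> x) ` hom C S X" by (metis image_image)
    also have "\<dots> = hom C S Y"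
    proof
      show "(\<lambda>x. u \<cdot> x) ` hom C S X \<subseteq> hom C S Y" using cmp_in_hom[OF _ u] by blast
      show "hom C S Y \<subseteq> (\<lambda>x. u \<cdot> x) ` hom C S X"
        using uv[OF S] cmp_in_hom[OF _ v] by (metis image_eqI subsetI)
    qed
    finally show "(\<lambda>x. u \<cdot> d 0 S x) ` fob (P 0) S = fob (H_functor C Y) S" by simp
  qed
  moreover have "pointwise_exact T (P (Suc i)) (P i) (d (Suc i)) ((d(0 := \<lambda>S x. u \<cdot> d 0 S x)) i)"
    if "i < n" for i
    using ex[OF that] u0 dX by (cases i) (auto simp: pointwise_exact_def)
  moreover have "pointwise_inj T (P n) ((d(0 := \<lambda>S x. u \<cdot> d 0 S x)) n)"
    using inj u_inj dX by (cases n) (auto simp: pointwise_inj_def inj_on_def)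
  ultimately show ?thesis
    using res nat_transf_comp[OF d0 nat_transf_cmp[OF u]] unfolding projective_resolution_def by simp
qed

lemma reduced_part_pd_infinite_iff:
  assumes "reduced_part C (shift_subcategory C T) X X'"
  shows "pd C T (H_functor C X) = \<infinity> \<longleftrightarrow> pd C T (H_functor C X') = \<infinity>"
proof -
  obtain u v where u: "u \<in> hom C X' X" and v: "v \<in> hom C X X'" and vu: "v \<cdot> u = idt C X'"
    and uvx: "\<And>S x. \<lbrakk>S \<in> T; x \<in> hom C S X\<rbrakk> \<Longrightarrow> u \<cdot> (v \<cdot> x) = x"
    using reduced_part_maps[OF assms] by metis
  have vux: "v \<cdot> (u \<cdot> x) = x" if "S \<in> T" "x \<in> hom C S X'" for S x
    using cmp_assoc[OF that(2) u v] vu that by simp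
  have "projective_resolution C T (H_functor C X') n P d \<Longrightarrow>
      projective_resolution C T (H_functor C X) n P (d(0 := \<lambda>S x. u \<cdot> d 0 S x))" for n P d
    using projective_resolution_transfer[OF u v] vux uvx by simp
  moreover have "projective_resolution C T (H_functor C X) n P d \<Longrightarrow>
      projective_resolution C T (H_functor C X') n P (d(0 := \<lambda>S x. v \<cdot> d 0 S x))" for n P d
    using projective_resolution_transfer[OF v u] vux uvx by simp
  ultimately show ?thesis unfolding pd_infinite_iff by blast
qed

end

theorem corollary4p3:
  fixes C :: "('o, 'm::ab_group_add, 'k::field) tri_cat" and T :: "'o set"
  assumes "triangulated_category C"
    and "hom_finite C"
    and "krull_schmidt C"
    and "cluster_tilting C T"
  shows "(\<forall>X. no_summands_in C (shift_subcategory C T) X \<longrightarrow>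
            (pd C T (H_functor C X) = \<infinity> \<longleftrightarrow>
               factor_ideal_nonzero C (shift_subcategory C T) X))
       \<and> (\<forall>X Xbar. reduced_part C (shift_subcategory C T) X Xbar \<longrightarrow>
            (pd C T (H_functor C X) = \<infinity> \<longleftrightarrow>
               factor_ideal_nonzero C (shift_subcategory C T) Xbar))"
proof -
  interpret triangulated_category C by fact
  interpret cluster_tilting_subcategory C T by unfold_locales fact
  have a: "pd C T (H_functor C X) = \<infinity> \<longleftrightarrow> factor_ideal_nonzero C (shift_subcategory C T) X"
    if "no_summands_in C (shift_subcategory C T) X" for X
    using pd_finite_if_factor_ideal_zero[of X] factor_ideal_zero_if_pd_finite[OF assms(3) that]
    unfolding pd_infinite_iff by blast
  \<comment> \<open>For (b), the reduced part satisfies the hypothesis of (a), and its functor has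
    infinite projective dimension exactly when that of \<open>X\<close> does.\<close>
  then show ?thesis
    using reduced_part_no_summands[OF assms(3)] reduced_part_pd_infinite_iff by blast
qed

end
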